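(* The product of unipotent crystals is associative: for any unipotent $G$-crystals $(\mathbf X_k,\mathbf f_{X_k})$, $k=1,2,3$, the two products $$\big((\mathbf X_1,\mathbf f_{X_1})\times(\mathbf X_2,\mathbf f_{X_2})\big)\times(\mathbf X_3,\mathbf f_{X_3})\quad\text{and}\quad(\mathbf X_1,\mathbf f_{X_1})\times\big((\mathbf X_2,\mathbf f_{X_2})\times(\mathbf X_3,\mathbf f_{X_3})\big)$$ coincide, i.e. their rational $U$-actions on $X_1\times X_2\times X_3$ are equal and their structure morphisms $X_1\times X_2\times X_3\to B^-$ are equal.
   Context: $G$ is a split reductive algebraic group over $\mathbb Q$, $T$ a maximal torus, $B,B^-$ opposite Borel subgroups with $B\cap B^-=T$, $U,U^-$ their unipotent radicals, $U_i\subset U$ ($i\in I$) the simple root subgroups. Let $\pi^-:G\to B^-$ and $\pi:G\to U$ be the rational morphisms, defined on $B^-\cdot U$, with $g=\pi^-(g)\pi(g)$. $U$ acts rationally on $B^-$ by $\alpha_{B^-}(u,b)=\pi^-(u\cdot b)$; $\mathbf B^-=(B^-,\alpha_{B^-})$. A $U$-variety $\mathbf X=(X,\alpha)$ is an irreducible variety $X$ over $\mathbb Q$ with a rational action $\alpha:U\times X\to X$, written $(u,x)\mapsto u(x)$, which is unital (its domain of definition contains $\{e\}\times X$) and whose restriction to each $U_i\times X$ is a rational action. A unipotent crystal is a pair $(\mathbf X,\mathbf f)$ with $\mathbf X$ a $U$-variety and $\mathbf f:X\to B^-$ a rational morphism commuting with the $U$-actions. The product $(\mathbf X,\mathbf f_X)\times(\mathbf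 Y,\mathbf f_Y)$ is $X\times Y$ with the rational $U$-action $u(x,y)=(u(x),(\pi(u\cdot\mathbf f_X(x)))(y))$ and the structure morphism $\mathbf f_{X\times Y}(x,y)=\mathbf f_X(x)\cdot\mathbf f_Y(y)$. *)

theory Defs
  imports "HOL-Analysis.Analysis" "HOL-Algebra.Solvable_Groups" "HOL-Library.Monad_Syntax"
begin

section \<open>Varieties over the rationals\<close>

text \<open>
  A variety \<open>X\<close> over \<open>\<rat>\<close> is a reduced separated scheme of finite type over \<open>\<rat>\<close>. It is encoded
  faithfully as a space with functions: the set \<open>X(\<complex>)\<close> of its complex points, with the
  \<open>\<rat>\<close>-Zariski topology (the open sets are those defined over \<open>\<rat>\<close>) and, for every such open
  set, the \<open>\<rat>\<close>-algebra of complex-valued functions on it that are regular over \<open>\<rat>\<close>. Only the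
  values of \<open>reg X V\<close> at open sets \<open>V\<close>, and only the values of its members at points of \<open>V\<close>,
  carry information.
\<close>

record 'a fspace =
  zariski :: "'a topology"
  reg :: "'a set \<Rightarrow> ('a \<Rightarrow> complex) set"

text \<open>The \<open>k\<close>-algebra of functions generated by a set \<open>C\<close>, for a subfield \<open>k\<close> of \<open>\<complex>\<close>.\<close>

inductive_set generated_algebra :: "complex set \<Rightarrow> ('a \<Rightarrow> complex) set \<Rightarrow> ('a \<Rightarrow> complex) set"
  for k C where
  const: "c \<in> k \<Longrightarrow> (\<lambda>_. c) \<in> generated_algebra k C"
| gen: "f \<in> C \<Longrightarrow> f \<in> generated_algebra k C"
| add: "\<lbrakk>f \<in> generated_algebra k C; g \<in> generated_algebra k C\<rbrakk>
          \<Longrightarrow> (\<lambda>x. f x + g x) \<in> generated_algebra k C"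
| mult: "\<lbrakk>f \<in> generated_algebra k C; g \<in> generated_algebra k C\<rbrakk>
          \<Longrightarrow> (\<lambda>x. f x * g x) \<in> generated_algebra k C"

text \<open>
  Given patches \<open>(V, A)\<close> consisting of a set and a set of functions on it, the sets
  \<open>{y \<in> V. h y \<noteq> 0}\<close> with \<open>h \<in> A\<close> generate the topology, and the regular functions are those that
  are locally quotients \<open>g / h\<close> with \<open>g, h \<in> A\<close>.
\<close>

definition fspace_of_patches :: "('a set \<times> ('a \<Rightarrow> complex) set) set \<Rightarrow> 'a fspace" where
  "fspace_of_patches P =
    \<lparr>zariski = topology_generated_by {{y \<in> V. h y \<noteq> 0} | V A h. (V, A) \<in> P \<and> h \<in> A},
     reg = (\<lambda>W. {f. \<forall>x\<in>W. \<exists>(V, A)\<in>P. \<exists>g\<in>A. \<exists>h\<in>A.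
                      x \<in> V \<and> h x \<noteq> 0 \<and> (\<forall>y\<in>W \<inter> V. h y \<noteq> 0 \<longrightarrow> f y = g y / h y)})\<rparr>"

text \<open>
  The structure induced on a subset \<open>Z\<close> of an affine space with coordinate functions \<open>C\<close>;
  polynomials have coefficients in \<open>k\<close>.
\<close>

definition affine_fspace :: "complex set \<Rightarrow> ('a \<Rightarrow> complex) set \<Rightarrow> 'a set \<Rightarrow> 'a fspace" where
  "affine_fspace k C Z = fspace_of_patches {(Z, generated_algebra k C)}"

definition open_subspace :: "'a fspace \<Rightarrow> 'a set \<Rightarrow> 'a fspace" where
  "open_subspace X V = \<lparr>zariski = subtopology (zariski X) V, reg = reg X\<rparr>"

text \<open>
  The functions on the patch \<open>V \<times> W\<close> are the finite sums of products \<open>a(x) b(y)\<close>, with \<open>a\<close> and \<open>b\<close>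
  regular over \<open>\<rat>\<close>; in particular the topology is the Zariski topology of the product variety and
  not the product topology.
\<close>

definition prod_fspace :: "'a fspace \<Rightarrow> 'b fspace \<Rightarrow> ('a \<times> 'b) fspace"  (infixr "\<otimes>\<^sub>v" 70) where
  "X \<otimes>\<^sub>v Y = fspace_of_patches
     {(V \<times> W, generated_algebra \<rat> ((\<lambda>a. a \<circ> fst) ` reg X V \<union> (\<lambda>b. b \<circ> snd) ` reg Y W)) | V W.
        openin (zariski X) V \<and> openin (zariski Y) W}"

definition regular_on :: "'a fspace \<Rightarrow> 'a set \<Rightarrow> ('a \<Rightarrow> 'b) \<Rightarrow> 'b fspace \<Rightarrow> bool" where
  "regular_on X W f Y \<longleftrightarrow>
     openin (zariski X) W \<and> f ` W \<subseteq> topspace (zariski Y) \<and>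
     (\<forall>V. openin (zariski Y) V \<longrightarrow>
        openin (zariski X) (W \<inter> f -` V) \<and> (\<forall>h\<in>reg Y V. h \<circ> f \<in> reg X (W \<inter> f -` V)))"

definition fspace_iso :: "'a fspace \<Rightarrow> 'b fspace \<Rightarrow> ('a \<Rightarrow> 'b) \<Rightarrow> bool" where
  "fspace_iso X Y f \<longleftrightarrow>
     bij_betw f (topspace (zariski X)) (topspace (zariski Y)) \<and>
     regular_on X (topspace (zariski X)) f Y \<and>
     regular_on Y (topspace (zariski Y)) (inv_into (topspace (zariski X)) f) X"

definition sheaf_of_functions :: "'a fspace \<Rightarrow> bool" where
  "sheaf_of_functions X \<longleftrightarrow>
     (\<forall>V. openin (zariski X) V \<longrightarrow> generated_algebra \<rat> (reg X V) \<subseteq> reg X V) \<and>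
     (\<forall>V W. openin (zariski X) V \<and> openin (zariski X) W \<and> W \<subseteq> V \<longrightarrow> reg X V \<subseteq> reg X W) \<and>
     (\<forall>W f. openin (zariski X) W \<and>
        (\<forall>x\<in>W. \<exists>V. openin (zariski X) V \<and> x \<in> V \<and> V \<subseteq> W \<and> (\<exists>g\<in>reg X V. \<forall>y\<in>V. f y = g y))
        \<longrightarrow> f \<in> reg X W)"

text \<open>Affine \<open>m\<close>-space consists of the sequences that vanish from index \<open>m\<close> on.\<close>

definition coordinates :: "nat \<Rightarrow> ((nat \<Rightarrow> complex) \<Rightarrow> complex) set" where
  "coordinates m = {(\<lambda>p. p i) | i. i < m}"

definition algebraic_set :: "nat \<Rightarrow> (nat \<Rightarrow> complex) set \<Rightarrow> bool" where
  "algebraic_set m Z \<longleftrightarrow>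
     (\<exists>S \<subseteq> generated_algebra \<rat> (coordinates m).
        Z = {p. (\<forall>i\<ge>m. p i = 0) \<and> (\<forall>q\<in>S. q p = 0)})"

definition affine_variety :: "'a fspace \<Rightarrow> bool" where
  "affine_variety X \<longleftrightarrow>
     (\<exists>m Z f. algebraic_set m Z \<and> fspace_iso X (affine_fspace \<rat> (coordinates m) Z) f)"

definition variety :: "'a fspace \<Rightarrow> bool" where
  "variety X \<longleftrightarrow>
     sheaf_of_functions X \<and>
     (\<exists>\<V>. finite \<V> \<and> \<Union>\<V> = topspace (zariski X) \<and>
          (\<forall>V\<in>\<V>. openin (zariski X) V \<and> affine_variety (open_subspace X V))) \<and>
     closedin (zariski (X \<otimes>\<^sub>v X)) {(x, x) | x. x \<in> topspace (zariski X)}"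

definition irreducible_variety :: "'a fspace \<Rightarrow> bool" where
  "irreducible_variety X \<longleftrightarrow>
     variety X \<and> topspace (zariski X) \<noteq> {} \<and>
     (\<forall>V W. openin (zariski X) V \<and> openin (zariski X) W \<and> V \<noteq> {} \<and> W \<noteq> {} \<longrightarrow> V \<inter> W \<noteq> {})"


section \<open>Rational morphisms\<close>

text \<open>
  The Zariski topology of the base change of \<open>X\<close> to \<open>\<complex>\<close>. An open set defined over \<open>\<rat>\<close> is dense
  for it iff it is dense for \<open>zariski X\<close>, because the projection from the base change to \<open>X\<close> is open and
  surjective.
\<close>

definition complex_top :: "'a fspace \<Rightarrow> 'a topology" where
  "complex_top X = topology_generated_by
     {{y \<in> V. h y \<noteq> 0} | V h. openin (zariski X) V \<and> h \<in> generated_algebra UNIV (reg X V)}"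

text \<open>
  A rational morphism is an equivalence class of regular morphisms defined on dense open sets.
  It is given by a representative, a partial function satisfying \<open>rational_map\<close>; \<open>rat_eq\<close> is equality
  of rational morphisms, and includes that both sides are rational maps; \<open>rat_dom\<close> is the domain of
  definition, which does not depend on the representative.
\<close>

definition rational_map :: "'a fspace \<Rightarrow> 'b fspace \<Rightarrow> ('a \<rightharpoonup> 'b) \<Rightarrow> bool" where
  "rational_map X Y f \<longleftrightarrow>
     complex_top X closure_of dom f = topspace (zariski X) \<and>
     regular_on X (dom f) (\<lambda>x. the (f x)) Y"

definition rat_eq :: "'a fspace \<Rightarrow> 'b fspace \<Rightarrow> ('a \<rightharpoonup> 'b) \<Rightarrow> ('a \<rightharpoonup> 'b) \<Rightarrow> bool" where
  "rat_eq X Y f g \<longleftrightarrow>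
     rational_map X Y f \<and> rational_map X Y g \<and>
     (\<exists>V. openin (zariski X) V \<and> complex_top X closure_of V = topspace (zariski X) \<and>
          V \<subseteq> dom f \<inter> dom g \<and> (\<forall>x\<in>V. f x = g x))"

definition rat_dom :: "'a fspace \<Rightarrow> 'b fspace \<Rightarrow> ('a \<rightharpoonup> 'b) \<Rightarrow> 'a set" where
  "rat_dom X Y f = \<Union>{dom g | g. rat_eq X Y f g}"


section \<open>Linear algebraic groups\<close>

text \<open>
  Linear algebraic groups are closed subgroups of a general linear group, identified with their
  groups of complex points.
\<close>

type_synonym 'n cmat = "complex^'n^'n"

definition GL :: "('n::finite) cmat monoid" where
  "GL = \<lparr>carrier = {A. invertible A}, monoid.mult = (**), one = mat 1\<rparr>"

definition entries :: "(('n::finite) cmat \<Rightarrow> complex) set" where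
  "entries = {(\<lambda>A. A $ i $ j) | i j. True}"

definition mat_fspace :: "complex set \<Rightarrow> ('n::finite) cmat set \<Rightarrow> 'n cmat fspace" where
  "mat_fspace k H = affine_fspace k entries H"

text \<open>
  In characteristic zero a closed subgroup is defined over \<open>\<rat>\<close> iff it is closed in the
  \<open>\<rat>\<close>-Zariski topology of the complex points.
\<close>

definition closed_subgroup :: "('n::finite) cmat set \<Rightarrow> bool" where
  "closed_subgroup H \<longleftrightarrow> subgroup H GL \<and> closedin (zariski (mat_fspace UNIV (carrier GL))) H"

definition over_Q :: "('n::finite) cmat set \<Rightarrow> bool" where
  "over_Q H \<longleftrightarrow> closedin (zariski (mat_fspace \<rat> (carrier GL))) H"

definition connected_group :: "('n::finite) cmat set \<Rightarrow> bool" where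
  "connected_group H \<longleftrightarrow> closed_subgroup H \<and> connected_space (zariski (mat_fspace UNIV H))"

definition unipotent :: "('n::finite) cmat \<Rightarrow> bool" where
  "unipotent A \<longleftrightarrow> (\<exists>m. (((**) (A - mat 1)) ^^ m) (mat 1) = 0)"

definition connected_normal_unipotent :: "('n::finite) cmat set \<Rightarrow> 'n cmat set \<Rightarrow> bool" where
  "connected_normal_unipotent H R \<longleftrightarrow>
     connected_group R \<and> R \<lhd> (GL\<lparr>carrier := H\<rparr>) \<and> (\<forall>A\<in>R. unipotent A)"

definition unipotent_radical :: "('n::finite) cmat set \<Rightarrow> 'n cmat set \<Rightarrow> bool" where
  "unipotent_radical H R \<longleftrightarrow>
     connected_normal_unipotent H R \<and> (\<forall>R'. connected_normal_unipotent H R' \<longrightarrow> R' \<subseteq> R)"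

definition reductive :: "('n::finite) cmat set \<Rightarrow> bool" where
  "reductive G \<longleftrightarrow> connected_group G \<and> unipotent_radical G {mat 1}"

text \<open>Tori over \<open>\<complex>\<close> for \<open>k = UNIV\<close>, and tori over \<open>\<rat>\<close> that are split for \<open>k = \<rat>\<close>.\<close>

definition torus :: "complex set \<Rightarrow> ('n::finite) cmat set \<Rightarrow> bool" where
  "torus k T \<longleftrightarrow> connected_group T \<and>
     (\<exists>P :: 'n cmat. (\<forall>i j. P $ i $ j \<in> k) \<and> invertible P \<and>
          (\<forall>A\<in>T. \<forall>i j. i \<noteq> j \<longrightarrow> (matrix_inv P ** A ** P) $ i $ j = 0))"

definition maximal_torus :: "('n::finite) cmat set \<Rightarrow> 'n cmat set \<Rightarrow> bool" where
  "maximal_torus G T \<longleftrightarrow> torus UNIV T \<and> T \<subseteq> G \<and>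
     (\<forall>T'. torus UNIV T' \<and> T \<subseteq> T' \<and> T' \<subseteq> G \<longrightarrow> T' = T)"

definition split_reductive :: "('n::finite) cmat set \<Rightarrow> 'n cmat set \<Rightarrow> bool" where
  "split_reductive G T \<longleftrightarrow>
     reductive G \<and> over_Q G \<and> maximal_torus G T \<and> over_Q T \<and> torus \<rat> T"

definition connected_solvable :: "('n::finite) cmat set \<Rightarrow> bool" where
  "connected_solvable B \<longleftrightarrow> connected_group B \<and> solvable (GL\<lparr>carrier := B\<rparr>)"

definition borel_subgroup :: "('n::finite) cmat set \<Rightarrow> 'n cmat set \<Rightarrow> bool" where
  "borel_subgroup G B \<longleftrightarrow> connected_solvable B \<and> B \<subseteq> G \<and>
     (\<forall>B'. connected_solvable B' \<and> B \<subseteq> B' \<and> B' \<subseteq> G \<longrightarrow> B' = B)"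

definition opposite_borels ::
    "('n::finite) cmat set \<Rightarrow> 'n cmat set \<Rightarrow> 'n cmat set \<Rightarrow> 'n cmat set \<Rightarrow> bool" where
  "opposite_borels G T B Bm \<longleftrightarrow>
     borel_subgroup G B \<and> over_Q B \<and> borel_subgroup G Bm \<and> over_Q Bm \<and> B \<inter> Bm = T"

text \<open>
  The tangent space at the identity: the differential at the identity of every polynomial that
  vanishes on \<open>H\<close> is zero on it. Here \<open>mat s ** X\<close> is the scalar multiple of \<open>X\<close> by \<open>s\<close>.
\<close>

definition lie_algebra :: "('n::finite) cmat set \<Rightarrow> 'n cmat set" where
  "lie_algebra H = {X. \<forall>p\<in>generated_algebra UNIV entries. (\<forall>A\<in>H. p A = 0) \<longrightarrow>
     ((\<lambda>s. p (mat 1 + mat s ** X)) has_field_derivative 0) (at 0)}"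

definition character :: "('n::finite) cmat set \<Rightarrow> ('n cmat \<Rightarrow> complex) \<Rightarrow> bool" where
  "character T \<alpha> \<longleftrightarrow> \<alpha> \<in> reg (mat_fspace UNIV T) T \<and>
     (\<forall>s\<in>T. \<alpha> s \<noteq> 0) \<and> (\<forall>s\<in>T. \<forall>t\<in>T. \<alpha> (s ** t) = \<alpha> s * \<alpha> t)"

definition root_space ::
    "('n::finite) cmat set \<Rightarrow> 'n cmat set \<Rightarrow> ('n cmat \<Rightarrow> complex) \<Rightarrow> 'n cmat set" where
  "root_space H T \<alpha> = {X \<in> lie_algebra H. \<forall>t\<in>T. t ** X ** matrix_inv t = mat (\<alpha> t) ** X}"

definition is_root :: "('n::finite) cmat set \<Rightarrow> 'n cmat set \<Rightarrow> ('n cmat \<Rightarrow> complex) \<Rightarrow> bool" where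
  "is_root H T \<alpha> \<longleftrightarrow> character T \<alpha> \<and> (\<exists>t\<in>T. \<alpha> t \<noteq> 1) \<and> (\<exists>X\<in>root_space H T \<alpha>. X \<noteq> 0)"

text \<open>
  The positive roots are the roots of \<open>B\<close>, and the simple roots are the indecomposable positive ones.
  Characters are written multiplicatively.
\<close>

definition simple_root :: "('n::finite) cmat set \<Rightarrow> 'n cmat set \<Rightarrow> ('n cmat \<Rightarrow> complex) \<Rightarrow> bool" where
  "simple_root B T \<alpha> \<longleftrightarrow> is_root B T \<alpha> \<and>
     \<not> (\<exists>\<beta> \<gamma>. is_root B T \<beta> \<and> is_root B T \<gamma> \<and> (\<forall>t\<in>T. \<alpha> t = \<beta> t * \<gamma> t))"

definition root_subgroup ::
    "('n::finite) cmat set \<Rightarrow> 'n cmat set \<Rightarrow> ('n cmat \<Rightarrow> complex) \<Rightarrow> 'n cmat set \<Rightarrow> bool" where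
  "root_subgroup G T \<alpha> V \<longleftrightarrow> connected_group V \<and> V \<subseteq> G \<and>
     (\<forall>t\<in>T. \<forall>v\<in>V. t ** v ** matrix_inv t \<in> V) \<and> lie_algebra V = root_space G T \<alpha>"

definition simple_root_subgroup ::
    "('n::finite) cmat set \<Rightarrow> 'n cmat set \<Rightarrow> 'n cmat set \<Rightarrow> 'n cmat set \<Rightarrow> bool" where
  "simple_root_subgroup G T B V \<longleftrightarrow> (\<exists>\<alpha>. simple_root B T \<alpha> \<and> root_subgroup G T \<alpha> V)"

text \<open>The rational morphisms \<open>\<pi>\<^sup>-\<close> and \<open>\<pi>\<close>, given by their representatives on \<open>B\<^sup>- \<cdot> U\<close>.\<close>

definition factorization :: "('n::finite) cmat set \<Rightarrow> 'n cmat set \<Rightarrow> 'n cmat set \<Rightarrow>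
    ('n cmat \<rightharpoonup> 'n cmat) \<Rightarrow> ('n cmat \<rightharpoonup> 'n cmat) \<Rightarrow> bool" where
  "factorization G Bm U piBm piU \<longleftrightarrow>
     rational_map (mat_fspace \<rat> G) (mat_fspace \<rat> Bm) piBm \<and>
     rational_map (mat_fspace \<rat> G) (mat_fspace \<rat> U) piU \<and>
     dom piBm = {b ** u | b u. b \<in> Bm \<and> u \<in> U} \<and>
     dom piU = {b ** u | b u. b \<in> Bm \<and> u \<in> U} \<and>
     (\<forall>g\<in>dom piU. g = the (piBm g) ** the (piU g))"


section \<open>Unipotent crystals\<close>

definition rational_action ::
    "('n::finite) cmat set \<Rightarrow> 'a fspace \<Rightarrow> ('n cmat \<times> 'a \<rightharpoonup> 'a) \<Rightarrow> bool" where
  "rational_action H X \<alpha> \<longleftrightarrow>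
     rational_map (mat_fspace \<rat> H \<otimes>\<^sub>v X) X \<alpha> \<and>
     rat_eq (mat_fspace \<rat> H \<otimes>\<^sub>v mat_fspace \<rat> H \<otimes>\<^sub>v X) X
       (\<lambda>(h, h', x). \<alpha> (h ** h', x))
       (\<lambda>(h, h', x). do { y \<leftarrow> \<alpha> (h', x); \<alpha> (h, y) }) \<and>
     (\<forall>\<beta> x. rat_eq (mat_fspace \<rat> H \<otimes>\<^sub>v X) X \<alpha> \<beta> \<and> (mat 1, x) \<in> dom \<beta> \<longrightarrow> \<beta> (mat 1, x) = Some x)"

definition unital :: "('n::finite) cmat set \<Rightarrow> 'a fspace \<Rightarrow> ('n cmat \<times> 'a \<rightharpoonup> 'a) \<Rightarrow> bool" where
  "unital H X \<alpha> \<longleftrightarrow> {mat 1} \<times> topspace (zariski X) \<subseteq> rat_dom (mat_fspace \<rat> H \<otimes>\<^sub>v X) X \<alpha>"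

text \<open>
  The restriction of a rational action to a subgroup is formed from a representative \<open>\<beta>\<close> whose domain
  is large enough to be dense in the restricted product; an arbitrary representative need not be
  defined anywhere on it.
\<close>

definition U_variety :: "('n::finite) cmat set \<Rightarrow> 'n cmat set \<Rightarrow> 'n cmat set \<Rightarrow> 'n cmat set \<Rightarrow>
    'a fspace \<Rightarrow> ('n cmat \<times> 'a \<rightharpoonup> 'a) \<Rightarrow> bool" where
  "U_variety G T B U X \<alpha> \<longleftrightarrow>
     irreducible_variety X \<and> rational_action U X \<alpha> \<and> unital U X \<alpha> \<and>
     (\<forall>V. simple_root_subgroup G T B V \<longrightarrow>
        (\<exists>\<beta>. rat_eq (mat_fspace \<rat> U \<otimes>\<^sub>v X) X \<alpha> \<beta> \<and>
             rational_action V X (\<beta> |` (V \<times> topspace (zariski X)))))"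

record ('a, 'n) crystal =
  underlying :: "'a fspace"
  act :: "'n cmat \<times> 'a \<rightharpoonup> 'a"
  str :: "'a \<rightharpoonup> 'n cmat"

text \<open>The structure morphism commutes with the action of \<open>U\<close> on \<open>B\<^sup>-\<close> by \<open>(u, b) \<mapsto> \<pi>\<^sup>-(u \<cdot> b)\<close>.\<close>

definition unipotent_crystal :: "('n::finite) cmat set \<Rightarrow> 'n cmat set \<Rightarrow> 'n cmat set \<Rightarrow>
    'n cmat set \<Rightarrow> 'n cmat set \<Rightarrow> ('n cmat \<rightharpoonup> 'n cmat) \<Rightarrow> ('a, 'n) crystal \<Rightarrow> bool" where
  "unipotent_crystal G T B Bm U piBm X \<longleftrightarrow>
     U_variety G T B U (underlying X) (act X) \<and>
     rational_map (underlying X) (mat_fspace \<rat> Bm) (str X) \<and>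
     rat_eq (mat_fspace \<rat> U \<otimes>\<^sub>v underlying X) (mat_fspace \<rat> Bm)
       (\<lambda>(u, x). do { y \<leftarrow> act X (u, x); str X y })
       (\<lambda>(u, x). do { b \<leftarrow> str X x; piBm (u ** b) })"

definition crystal_prod :: "(('n::finite) cmat \<rightharpoonup> 'n cmat) \<Rightarrow> ('a, 'n) crystal \<Rightarrow>
    ('b, 'n) crystal \<Rightarrow> ('a \<times> 'b, 'n) crystal" where
  "crystal_prod piU X Y =
    \<lparr>underlying = underlying X \<otimes>\<^sub>v underlying Y,
     act = (\<lambda>(u, x, y). do {
              x' \<leftarrow> act X (u, x);
              b \<leftarrow> str X x;
              v \<leftarrow> piU (u ** b);
              y' \<leftarrow> act Y (v, y);
              Some (x', y') }),
     str = (\<lambda>(x, y). do { b \<leftarrow> str X x; c \<leftarrow> str Y y; Some (b ** c) })\<rparr>"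

definition reassoc :: "('a \<times> 'b) \<times> 'c \<Rightarrow> 'a \<times> 'b \<times> 'c" where
  "reassoc = (\<lambda>((x, y), z). (x, y, z))"

end

theory Submission
  imports Defs
begin

text \<open>
  Write \<open>v = \<pi>(u f\<^sub>1(x))\<close>. Since \<open>\<pi>(b g) = \<pi>(g)\<close> for \<open>b \<in> B\<^sup>-\<close>, one has
  \<open>\<pi>(u f\<^sub>1(x) f\<^sub>2(y)) = \<pi>(v f\<^sub>2(y))\<close>, so the two actions agree as partial functions; this uses
  \<open>B\<^sup>- \<inter> U = 1\<close>, which holds because a unipotent element of the torus \<open>B \<inter> B\<^sup>-\<close> is trivial.
  What remains is that the product formulas define rational maps. Their domains are dense because
  \<open>U\<close> is irreducible and \<open>u \<mapsto> \<pi>(u b)\<close> is birational on \<open>U\<close>, so that the conditions on \<open>u\<close>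
  for fixed \<open>x\<close> and \<open>y\<close> are nonempty open and can be met simultaneously.
\<close>

section \<open>Spaces with functions\<close>

text \<open>The obstacle is that \<open>rat_eq\<close> contains two requirements on different
  topologies: a rational map is regular over the rationals, but its domain must be dense in the
  finer \<open>complex_top\<close>. Both topologies are therefore carried along. Regularity is
  assembled from projections, pairing, composition and matrix multiplication. This uses only that
  regular functions form a sheaf and are invertible near each point where they do not vanish. That
  property (\<open>function_space\<close>) passes from affine sets to varieties and to products, so
  a product never has to be recognised as a variety. For density, points of a product are moved one
  coordinate at a time, because slices of open sets are open in \<open>complex_top\<close>.
  Irreducibility is obtained without an exponential map: the powers of a unipotent matrix depend
  polynomially on the exponent, and a nonzero polynomial cannot vanish at all natural
  numbers.\<close>

lemma generated_algebra_mono: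
  "k \<subseteq> k' \<Longrightarrow> C \<subseteq> C' \<Longrightarrow> generated_algebra k C \<subseteq> generated_algebra k' C'"
proof
  fix f assume "k \<subseteq> k'" "C \<subseteq> C'" "f \<in> generated_algebra k C"
  from this(3) show "f \<in> generated_algebra k' C'"
    by induction (use \<open>k \<subseteq> k'\<close> \<open>C \<subseteq> C'\<close> in \<open>auto intro: generated_algebra.intros\<close>)
qed

lemma generated_algebra_idem:
  "generated_algebra k (generated_algebra k C) \<subseteq> generated_algebra k C"
proof
  fix f assume "f \<in> generated_algebra k (generated_algebra k C)"
  then show "f \<in> generated_algebra k C"
    by induction (auto intro: generated_algebra.intros)
qed

lemma generated_algebra_comp:
  assumes "f \<in> generated_algebra k C" "\<And>c. c \<in> C \<Longrightarrow> c \<circ> \<phi> \<in> generated_algebra k D"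
  shows "f \<circ> \<phi> \<in> generated_algebra k D"
  using assms(1)
  by induction (use assms(2) in \<open>auto simp: o_def intro: generated_algebra.intros\<close>)

text \<open>\<open>topology_generated_by\<close> starts from a subbasis. The refinement hypothesis
  makes the subbasis a basis, and only the intersection case of the induction uses it.\<close>

lemma openin_generated_basis:
  assumes "\<And>B C x. \<lbrakk>B \<in> \<B>; C \<in> \<B>; x \<in> B; x \<in> C\<rbrakk> \<Longrightarrow> \<exists>D\<in>\<B>. x \<in> D \<and> D \<subseteq> B \<inter> C"
    and "openin (topology_generated_by \<B>) S" "x \<in> S"
  shows "\<exists>B\<in>\<B>. x \<in> B \<and> B \<subseteq> S"
proof -
  have "generate_topology_on \<B> S"
    using assms(2) by (simp add: openin_topology_generated_by)
  then show ?thesis using assms(3)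
  proof (induction arbitrary: x)
    case (Int a b)
    then obtain B C where "B \<in> \<B>" "x \<in> B" "B \<subseteq> a" "C \<in> \<B>" "x \<in> C" "C \<subseteq> b"
      by (meson IntD1 IntD2)
    then obtain D where "D \<in> \<B>" "x \<in> D" "D \<subseteq> B \<inter> C" using assms(1)[of B C x] by metis
    with \<open>B \<subseteq> a\<close> \<open>C \<subseteq> b\<close> show ?case by (intro bexI[of _ D]) auto
  next
    case (UN K)
    then obtain S where "S \<in> K" "x \<in> S" by blast
    then obtain B where "B \<in> \<B>" "x \<in> B" "B \<subseteq> S" using UN.IH by blast
    with \<open>S \<in> K\<close> show ?case by (intro bexI[of _ B]) auto
  qed auto
qed

text \<open>The common ground of varieties, matrix groups and their products. The last two axioms
  say that a regular function that does not vanish at a point is a unit near it, which is what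
  quotients of regular functions require.\<close>

locale function_space =
  fixes X :: "'a fspace"
  assumes sheaf: "sheaf_of_functions X"
    and openin_nonvanishing:
      "\<lbrakk>openin (zariski X) V; h \<in> reg X V\<rbrakk> \<Longrightarrow> openin (zariski X) {x \<in> V. h x \<noteq> 0}"
    and inverse_regular:
      "\<lbrakk>openin (zariski X) V; h \<in> reg X V\<rbrakk> \<Longrightarrow> (\<lambda>x. inverse (h x)) \<in> reg X {x \<in> V. h x \<noteq> 0}"
begin

lemma regular_algebra:
  "openin (zariski X) V \<Longrightarrow> f \<in> generated_algebra \<rat> (reg X V) \<Longrightarrow> f \<in> reg X V"
  using sheaf[unfolded sheaf_of_functions_def, THEN conjunct1] by (meson subsetD)

lemma regular_const: "openin (zariski X) V \<Longrightarrow> c \<in> \<rat> \<Longrightarrow> (\<lambda>_. c) \<in> reg X V"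
  by (blast intro: regular_algebra generated_algebra.intros)

lemma regular_add:
  "openin (zariski X) V \<Longrightarrow> f \<in> reg X V \<Longrightarrow> g \<in> reg X V \<Longrightarrow> (\<lambda>x. f x + g x) \<in> reg X V"
  by (blast intro: regular_algebra generated_algebra.intros)

lemma regular_mult:
  "openin (zariski X) V \<Longrightarrow> f \<in> reg X V \<Longrightarrow> g \<in> reg X V \<Longrightarrow> (\<lambda>x. f x * g x) \<in> reg X V"
  by (blast intro: regular_algebra generated_algebra.intros)

lemma regular_restrict:
  "openin (zariski X) V \<Longrightarrow> openin (zariski X) W \<Longrightarrow> W \<subseteq> V \<Longrightarrow> f \<in> reg X V \<Longrightarrow> f \<in> reg X W"
  using sheaf[unfolded sheaf_of_functions_def, THEN conjunct2, THEN conjunct1] by (meson subsetD)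

lemma regular_local:
  assumes "openin (zariski X) W"
    and "\<And>x. x \<in> W \<Longrightarrow>
      \<exists>V g. openin (zariski X) V \<and> x \<in> V \<and> V \<subseteq> W \<and> g \<in> reg X V \<and> (\<forall>y\<in>V. f y = g y)"
  shows "f \<in> reg X W"
proof -
  have "\<forall>x\<in>W. \<exists>V. openin (zariski X) V \<and> x \<in> V \<and> V \<subseteq> W \<and> (\<exists>g\<in>reg X V. \<forall>y\<in>V. f y = g y)"
    using assms(2) by meson
  then show ?thesis
    using sheaf[unfolded sheaf_of_functions_def, THEN conjunct2, THEN conjunct2] assms(1) by blast
qed

lemma regular_cong:
  "openin (zariski X) W \<Longrightarrow> g \<in> reg X W \<Longrightarrow> (\<And>x. x \<in> W \<Longrightarrow> f x = g x) \<Longrightarrow> f \<in> reg X W"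
  by (rule regular_local) blast+

end

text \<open>The condition under which local quotients can be brought to a common denominator: two
  patches around a point have a common refinement that carries both algebras.\<close>

definition directed_patches :: "('a set \<times> ('a \<Rightarrow> complex) set) set \<Rightarrow> bool" where
  "directed_patches P \<longleftrightarrow>
     (\<forall>V A. (V, A) \<in> P \<longrightarrow> generated_algebra \<rat> A \<subseteq> A) \<and>
     (\<forall>V A V' A' x. (V, A) \<in> P \<and> (V', A') \<in> P \<and> x \<in> V \<inter> V' \<longrightarrow>
        (\<exists>V'' A''. (V'', A'') \<in> P \<and> x \<in> V'' \<and> V'' \<subseteq> V \<inter> V' \<and> A \<union> A' \<subseteq> A''))"

section \<open>Calculus of local quotients on a directed system of patches\<close>

context
  fixes P :: "('a set \<times> ('a \<Rightarrow> complex) set) set"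
  assumes directed: "directed_patches P"
begin

lemma patch_refine:
  assumes "(V, A) \<in> P" "(V', A') \<in> P" "x \<in> V" "x \<in> V'"
  obtains V'' A'' where "(V'', A'') \<in> P" "x \<in> V''" "V'' \<subseteq> V" "V'' \<subseteq> V'" "A \<subseteq> A''" "A' \<subseteq> A''"
proof -
  have "x \<in> V \<inter> V'" using assms by blast
  then have "\<exists>V'' A''. (V'', A'') \<in> P \<and> x \<in> V'' \<and> V'' \<subseteq> V \<inter> V' \<and> A \<union> A' \<subseteq> A''"
    using directed assms(1,2) unfolding directed_patches_def by blast
  then show ?thesis using that by (metis le_sup_iff le_inf_iff)
qed

lemma patch_algebra: "(V, A) \<in> P \<Longrightarrow> f \<in> generated_algebra \<rat> A \<Longrightarrow> f \<in> A"
  using directed unfolding directed_patches_def by blast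

lemma patch_const: "(V, A) \<in> P \<Longrightarrow> c \<in> \<rat> \<Longrightarrow> (\<lambda>_. c) \<in> A"
  by (blast intro: patch_algebra generated_algebra.intros)

lemma patch_add: "(V, A) \<in> P \<Longrightarrow> f \<in> A \<Longrightarrow> g \<in> A \<Longrightarrow> (\<lambda>x. f x + g x) \<in> A"
  by (blast intro: patch_algebra generated_algebra.intros)

lemma patch_mult: "(V, A) \<in> P \<Longrightarrow> f \<in> A \<Longrightarrow> g \<in> A \<Longrightarrow> (\<lambda>x. f x * g x) \<in> A"
  by (blast intro: patch_algebra generated_algebra.intros)

text \<open>On a common refinement, the loci where \<open>h\<close> and \<open>h'\<close> do not
  vanish meet in the locus of \<open>h * h'\<close>, so the generating sets already form a
  basis.\<close>

lemma patches_basis: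
  assumes "openin (zariski (fspace_of_patches P)) S" "x \<in> S"
  obtains V A h where "(V, A) \<in> P" "h \<in> A" "x \<in> V" "h x \<noteq> 0" "{y \<in> V. h y \<noteq> 0} \<subseteq> S"
proof -
  let ?B = "{{y \<in> V. h y \<noteq> 0} | V A h. (V, A) \<in> P \<and> h \<in> A}"
  have "\<exists>B\<in>?B. x \<in> B \<and> B \<subseteq> S"
  proof (rule openin_generated_basis)
    show "openin (topology_generated_by ?B) S" using assms(1) by (simp add: fspace_of_patches_def)
    fix B C x assume "B \<in> ?B" "C \<in> ?B" "x \<in> B" "x \<in> C"
    then obtain V A h V' A' h' where *: "(V, A) \<in> P" "h \<in> A" "B = {y \<in> V. h y \<noteq> 0}"
      "(V', A') \<in> P" "h' \<in> A'" "C = {y \<in> V'. h' y \<noteq> 0}" by auto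
    then have "x \<in> V" "x \<in> V'" using \<open>x \<in> B\<close> \<open>x \<in> C\<close> by auto
    then obtain V'' A'' where V'': "(V'', A'') \<in> P" "x \<in> V''" "V'' \<subseteq> V" "V'' \<subseteq> V'" "A \<subseteq> A''" "A' \<subseteq> A''"
      by (rule patch_refine[OF *(1,4)]) (rule that)
    have "(\<lambda>y. h y * h' y) \<in> A''" using *(2,5) V''(5,6) by (intro patch_mult[OF V''(1)]) blast+
    then have "{y \<in> V''. h y * h' y \<noteq> 0} \<in> ?B"
      using V''(1) by (intro CollectI exI[of _ V''] exI[of _ A''] exI[of _ "\<lambda>y. h y * h' y"]) simp
    moreover have "x \<in> {y \<in> V''. h y * h' y \<noteq> 0}" "{y \<in> V''. h y * h' y \<noteq> 0} \<subseteq> B \<inter> C"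
      using \<open>x \<in> B\<close> \<open>x \<in> C\<close> V''(2-4) unfolding *(3,6) by auto
    ultimately show "\<exists>D\<in>?B. x \<in> D \<and> D \<subseteq> B \<inter> C" by (intro bexI[of _ "{y \<in> V''. h y * h' y \<noteq> 0}"] conjI)
  qed (fact assms(2))
  then obtain V A h where "(V, A) \<in> P" "h \<in> A" "x \<in> {y \<in> V. h y \<noteq> 0}" "{y \<in> V. h y \<noteq> 0} \<subseteq> S"
    by auto
  then show ?thesis using that by simp
qed

lemma openin_patch_nonvanishing:
  "(V, A) \<in> P \<Longrightarrow> h \<in> A \<Longrightarrow> openin (zariski (fspace_of_patches P)) {y \<in> V. h y \<noteq> 0}"
  unfolding fspace_of_patches_def by (auto intro!: topology_generated_by_Basis)

lemma openin_patch: "(V, A) \<in> P \<Longrightarrow> openin (zariski (fspace_of_patches P)) V"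
  using openin_patch_nonvanishing[of V A "\<lambda>_. 1"] patch_const[of V A 1] by simp

lemma topspace_patches: "topspace (zariski (fspace_of_patches P)) = (\<Union>(V, A)\<in>P. V)"
proof
  show "topspace (zariski (fspace_of_patches P)) \<subseteq> (\<Union>(V, A)\<in>P. V)"
    by (auto simp: fspace_of_patches_def)
  show "(\<Union>(V, A)\<in>P. V) \<subseteq> topspace (zariski (fspace_of_patches P))"
    using openin_patch openin_subset by fastforce
qed

lemma patches_reg_iff:
  "f \<in> reg (fspace_of_patches P) W \<longleftrightarrow>
     (\<forall>x\<in>W. \<exists>V A. (V, A) \<in> P \<and> (\<exists>g\<in>A. \<exists>h\<in>A. x \<in> V \<and> h x \<noteq> 0 \<and>
        (\<forall>y\<in>W \<inter> V. h y \<noteq> 0 \<longrightarrow> f y = g y / h y)))"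
proof -
  have "(\<exists>p\<in>P. case p of (V, A) \<Rightarrow> R V A) \<longleftrightarrow> (\<exists>V A. (V, A) \<in> P \<and> R V A)" for R
    by auto
  then show ?thesis by (simp only: fspace_of_patches_def fspace.select_convs mem_Collect_eq)
qed

lemma patches_regI:
  assumes "\<And>x. x \<in> W \<Longrightarrow> \<exists>V A g h. (V, A) \<in> P \<and> g \<in> A \<and> h \<in> A \<and> x \<in> V \<and> h x \<noteq> 0 \<and>
      (\<forall>y\<in>W \<inter> V. h y \<noteq> 0 \<longrightarrow> f y = g y / h y)"
  shows "f \<in> reg (fspace_of_patches P) W"
  unfolding patches_reg_iff
proof
  fix x assume "x \<in> W"
  then obtain V A g h where *: "(V, A) \<in> P" "g \<in> A" "h \<in> A" "x \<in> V \<and> h x \<noteq> 0 \<and>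
      (\<forall>y\<in>W \<inter> V. h y \<noteq> 0 \<longrightarrow> f y = g y / h y)"
    by (elim assms[elim_format] exE conjE) (rule that; simp)
  then show "\<exists>V A. (V, A) \<in> P \<and> (\<exists>g\<in>A. \<exists>h\<in>A. x \<in> V \<and> h x \<noteq> 0 \<and>
        (\<forall>y\<in>W \<inter> V. h y \<noteq> 0 \<longrightarrow> f y = g y / h y))"
    by - (rule exI[of _ V], rule exI[of _ A], rule conjI, assumption,
        rule bexI[of _ g], rule bexI[of _ h], assumption+)
qed

lemma patches_regE:
  assumes "f \<in> reg (fspace_of_patches P) W" "x \<in> W"
  obtains V A g h where "(V, A) \<in> P" "g \<in> A" "h \<in> A" "x \<in> V" "h x \<noteq> 0"
    "\<And>y. y \<in> W \<Longrightarrow> y \<in> V \<Longrightarrow> h y \<noteq> 0 \<Longrightarrow> f y = g y / h y"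
proof -
  obtain V A where VA: "(V, A) \<in> P" "\<exists>g\<in>A. \<exists>h\<in>A. x \<in> V \<and> h x \<noteq> 0 \<and>
      (\<forall>y\<in>W \<inter> V. h y \<noteq> 0 \<longrightarrow> f y = g y / h y)"
    using bspec[OF assms(1)[unfolded patches_reg_iff] assms(2)] by (elim exE conjE) (rule that)
  from VA(2) obtain g h where gh: "g \<in> A" "h \<in> A" "x \<in> V" "h x \<noteq> 0"
      "\<forall>y\<in>W \<inter> V. h y \<noteq> 0 \<longrightarrow> f y = g y / h y"
    by (elim bexE conjE) (rule that)
  show ?thesis
    by (rule that[OF VA(1) gh(1-4)]) (use gh(5) in simp)
qed

lemma patch_subset_reg: "(V, A) \<in> P \<Longrightarrow> A \<subseteq> reg (fspace_of_patches P) V"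
proof
  fix g assume *: "(V, A) \<in> P" "g \<in> A"
  then have "(\<lambda>_. 1) \<in> A" by (simp add: patch_const)
  with * show "g \<in> reg (fspace_of_patches P) V"
    by - (rule patches_regI, rule exI[of _ V], rule exI[of _ A], rule exI[of _ g], rule exI[of _ "\<lambda>_. 1"], auto)
qed

text \<open>Common denominator: on a refinement of the two patches both fractions are expanded to
  the denominator \<open>h1 * h2\<close>. Sums and products of regular functions rest on
  this.\<close>

lemma patches_reg2E:
  assumes "f \<in> reg (fspace_of_patches P) W" "f' \<in> reg (fspace_of_patches P) W" "x \<in> W"
  obtains V A g g' h where "(V, A) \<in> P" "g \<in> A" "g' \<in> A" "h \<in> A" "x \<in> V" "h x \<noteq> 0"
    "\<And>y. y \<in> W \<Longrightarrow> y \<in> V \<Longrightarrow> h y \<noteq> 0 \<Longrightarrow> f y = g y / h y \<and> f' y = g' y / h y"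
proof -
  obtain V1 A1 g1 h1 where 1: "(V1, A1) \<in> P" "g1 \<in> A1" "h1 \<in> A1" "x \<in> V1" "h1 x \<noteq> 0"
    "\<And>y. y \<in> W \<Longrightarrow> y \<in> V1 \<Longrightarrow> h1 y \<noteq> 0 \<Longrightarrow> f y = g1 y / h1 y"
    by (rule patches_regE[OF assms(1,3)]) (rule that)
  obtain V2 A2 g2 h2 where 2: "(V2, A2) \<in> P" "g2 \<in> A2" "h2 \<in> A2" "x \<in> V2" "h2 x \<noteq> 0"
    "\<And>y. y \<in> W \<Longrightarrow> y \<in> V2 \<Longrightarrow> h2 y \<noteq> 0 \<Longrightarrow> f' y = g2 y / h2 y"
    by (rule patches_regE[OF assms(2,3)]) (rule that)
  obtain V A where 3: "(V, A) \<in> P" "x \<in> V" "V \<subseteq> V1" "V \<subseteq> V2" "A1 \<subseteq> A" "A2 \<subseteq> A"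
    by (rule patch_refine[OF 1(1) 2(1) 1(4) 2(4)]) (rule that)
  show ?thesis
  proof (rule that[OF 3(1)])
    show "(\<lambda>y. g1 y * h2 y) \<in> A" "(\<lambda>y. g2 y * h1 y) \<in> A" "(\<lambda>y. h1 y * h2 y) \<in> A"
      using 1(2,3) 2(2,3) 3(5,6) by (intro patch_mult[OF 3(1)]; blast)+
    fix y assume "y \<in> W" "y \<in> V" "h1 y * h2 y \<noteq> 0"
    then show "f y = g1 y * h2 y / (h1 y * h2 y) \<and> f' y = g2 y * h1 y / (h1 y * h2 y)"
      using 1(6)[of y] 2(6)[of y] 3 by auto
  qed (use 1 2 3 in auto)
qed

text \<open>Expanding the fraction by a function \<open>h2\<close> whose nonvanishing locus lies in
  \<open>W\<close> makes the quotient formula valid wherever the new denominator is nonzero, with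
  membership in \<open>W\<close> as a consequence and no longer a premise.\<close>

lemma patches_reg_nbhdE:
  assumes "f \<in> reg (fspace_of_patches P) W" "openin (zariski (fspace_of_patches P)) W" "x \<in> W"
  obtains V A g h where "(V, A) \<in> P" "g \<in> A" "h \<in> A" "x \<in> V" "h x \<noteq> 0"
    "\<And>y. y \<in> V \<Longrightarrow> h y \<noteq> 0 \<Longrightarrow> y \<in> W \<and> f y = g y / h y"
proof -
  obtain V1 A1 g1 h1 where 1: "(V1, A1) \<in> P" "g1 \<in> A1" "h1 \<in> A1" "x \<in> V1" "h1 x \<noteq> 0"
    "\<And>y. y \<in> W \<Longrightarrow> y \<in> V1 \<Longrightarrow> h1 y \<noteq> 0 \<Longrightarrow> f y = g1 y / h1 y"
    by (rule patches_regE[OF assms(1,3)]) (rule that)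
  obtain V2 A2 h2 where 2: "(V2, A2) \<in> P" "h2 \<in> A2" "x \<in> V2" "h2 x \<noteq> 0" "{y \<in> V2. h2 y \<noteq> 0} \<subseteq> W"
    by (rule patches_basis[OF assms(2,3)]) (rule that)
  obtain V A where 3: "(V, A) \<in> P" "x \<in> V" "V \<subseteq> V1" "V \<subseteq> V2" "A1 \<subseteq> A" "A2 \<subseteq> A"
    by (rule patch_refine[OF 1(1) 2(1) 1(4) 2(3)]) (rule that)
  show ?thesis
  proof (rule that[OF 3(1)])
    show "(\<lambda>y. g1 y * h2 y) \<in> A" "(\<lambda>y. h1 y * h2 y) \<in> A"
      using 1(2,3) 2(2,3) 3(5,6) by (intro patch_mult[OF 3(1)]; blast)+
    fix y assume "y \<in> V" "h1 y * h2 y \<noteq> 0"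
    then show "y \<in> W \<and> f y = g1 y * h2 y / (h1 y * h2 y)"
      using 1(6)[of y] 2(5) 3 by auto
  qed (use 1 2 3 in auto)
qed

lemma function_space_patches: "function_space (fspace_of_patches P)"
proof
  let ?X = "fspace_of_patches P"
  have alg: "f \<in> reg ?X V" if V: "openin (zariski ?X) V" and "f \<in> generated_algebra \<rat> (reg ?X V)" for f V
    using that(2)
  proof induction
    case (const c)
    show ?case
    proof (rule patches_regI)
      fix x assume "x \<in> V"
      then obtain V' A' where "(V', A') \<in> P" "x \<in> V'" by (rule patches_basis[OF V]) (rule that)
      then show "\<exists>V' A g h. (V', A) \<in> P \<and> g \<in> A \<and> h \<in> A \<and> x \<in> V' \<and> h x \<noteq> 0 \<and>
          (\<forall>y\<in>V \<inter> V'. h y \<noteq> 0 \<longrightarrow> c = g y / h y)"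
        using const by - (rule exI[of _ V'], rule exI[of _ A'], rule exI[of _ "\<lambda>_. c"], rule exI[of _ "\<lambda>_. 1"], (auto simp: patch_const))
    qed
  next
    case (add f g)
    show ?case
    proof (rule patches_regI)
      fix x assume "x \<in> V"
      then obtain V' A a b h where *: "(V', A) \<in> P" "a \<in> A" "b \<in> A" "h \<in> A" "x \<in> V'" "h x \<noteq> 0"
        "\<And>y. y \<in> V \<Longrightarrow> y \<in> V' \<Longrightarrow> h y \<noteq> 0 \<Longrightarrow> f y = a y / h y \<and> g y = b y / h y"
        by (rule patches_reg2E[OF add.IH]) (rule that)
      then show "\<exists>V' A a h. (V', A) \<in> P \<and> a \<in> A \<and> h \<in> A \<and> x \<in> V' \<and> h x \<noteq> 0 \<and>
          (\<forall>y\<in>V \<inter> V'. h y \<noteq> 0 \<longrightarrow> f y + g y = a y / h y)"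
        by - (rule exI[of _ V'], rule exI[of _ A], rule exI[of _ "\<lambda>y. a y + b y"], rule exI[of _ h], (auto simp: add_divide_distrib intro: patch_add))
    qed
  next
    case (mult f g)
    show ?case
    proof (rule patches_regI)
      fix x assume "x \<in> V"
      then obtain V' A a b h where *: "(V', A) \<in> P" "a \<in> A" "b \<in> A" "h \<in> A" "x \<in> V'" "h x \<noteq> 0"
        "\<And>y. y \<in> V \<Longrightarrow> y \<in> V' \<Longrightarrow> h y \<noteq> 0 \<Longrightarrow> f y = a y / h y \<and> g y = b y / h y"
        by (rule patches_reg2E[OF mult.IH]) (rule that)
      then show "\<exists>V' A a h. (V', A) \<in> P \<and> a \<in> A \<and> h \<in> A \<and> x \<in> V' \<and> h x \<noteq> 0 \<and>
          (\<forall>y\<in>V \<inter> V'. h y \<noteq> 0 \<longrightarrow> f y * g y = a y / h y)"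
        by - (rule exI[of _ V'], rule exI[of _ A], rule exI[of _ "\<lambda>y. a y * b y"], rule exI[of _ "\<lambda>y. h y * h y"], (auto intro: patch_mult))
    qed
  qed
  have restr: "reg ?X V \<subseteq> reg ?X W" if "W \<subseteq> V" for V W
  proof
    fix f assume f: "f \<in> reg ?X V"
    show "f \<in> reg ?X W"
    proof (rule patches_regI)
      fix x assume "x \<in> W"
      then have "x \<in> V" using that by blast
      then obtain V1 A1 g1 h1 where "(V1, A1) \<in> P" "g1 \<in> A1" "h1 \<in> A1" "x \<in> V1" "h1 x \<noteq> 0"
        "\<And>y. y \<in> V \<Longrightarrow> y \<in> V1 \<Longrightarrow> h1 y \<noteq> 0 \<Longrightarrow> f y = g1 y / h1 y"
        by (rule patches_regE[OF f]) (rule that)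
      then show "\<exists>V A g h. (V, A) \<in> P \<and> g \<in> A \<and> h \<in> A \<and> x \<in> V \<and> h x \<noteq> 0 \<and>
          (\<forall>y\<in>W \<inter> V. h y \<noteq> 0 \<longrightarrow> f y = g y / h y)"
        using that by - (rule exI[of _ V1], rule exI[of _ A1], rule exI[of _ g1], rule exI[of _ h1], auto)
    qed
  qed
  have loc: "f \<in> reg ?X W"
    if locally: "\<forall>x\<in>W. \<exists>V. openin (zariski ?X) V \<and> x \<in> V \<and> V \<subseteq> W \<and> (\<exists>g\<in>reg ?X V. \<forall>y\<in>V. f y = g y)"
    for W f
  proof (rule patches_regI)
    fix x assume "x \<in> W"
    then obtain V g where V: "openin (zariski ?X) V" "x \<in> V" "V \<subseteq> W" "g \<in> reg ?X V" "\<forall>y\<in>V. f y = g y"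
      using locally by blast
    obtain V1 A1 g1 h1 where "(V1, A1) \<in> P" "g1 \<in> A1" "h1 \<in> A1" "x \<in> V1" "h1 x \<noteq> 0"
      "\<And>y. y \<in> V1 \<Longrightarrow> h1 y \<noteq> 0 \<Longrightarrow> y \<in> V \<and> g y = g1 y / h1 y"
      by (rule patches_reg_nbhdE[OF V(4,1,2)]) (rule that)
    then show "\<exists>V A g h. (V, A) \<in> P \<and> g \<in> A \<and> h \<in> A \<and> x \<in> V \<and> h x \<noteq> 0 \<and>
        (\<forall>y\<in>W \<inter> V. h y \<noteq> 0 \<longrightarrow> f y = g y / h y)"
      using V by - (rule exI[of _ V1], rule exI[of _ A1], rule exI[of _ g1], rule exI[of _ h1], auto)
  qed
  show "sheaf_of_functions ?X"
    unfolding sheaf_of_functions_def using alg restr loc by blast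
next
  let ?X = "fspace_of_patches P"
  fix V h assume *: "openin (zariski ?X) V" "h \<in> reg ?X V"
  show "openin (zariski ?X) {x \<in> V. h x \<noteq> 0}"
  proof (subst openin_subopen, safe)
    fix x assume x: "x \<in> V" "h x \<noteq> 0"
    obtain V1 A1 a b where 1: "(V1, A1) \<in> P" "a \<in> A1" "b \<in> A1" "x \<in> V1" "b x \<noteq> 0"
      "\<And>y. y \<in> V1 \<Longrightarrow> b y \<noteq> 0 \<Longrightarrow> y \<in> V \<and> h y = a y / b y"
      by (rule patches_reg_nbhdE[OF *(2,1) x(1)]) (rule that)
    \<comment> \<open>Where \<open>b\<close> is nonzero, \<open>h\<close> equals
      \<open>a / b\<close>; hence \<open>a * b\<close> is nonzero only at points of \<open>V\<close>
      where \<open>h\<close> is nonzero.\<close>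
    then have "openin (zariski ?X) {y \<in> V1. a y * b y \<noteq> 0}"
      by (intro openin_patch_nonvanishing[OF 1(1)] patch_mult[OF 1(1)])
    moreover have "x \<in> {y \<in> V1. a y * b y \<noteq> 0}" using 1(4,5) 1(6)[of x] x by auto
    moreover have "{y \<in> V1. a y * b y \<noteq> 0} \<subseteq> {x \<in> V. h x \<noteq> 0}" using 1(6) by auto
    ultimately show "\<exists>T. openin (zariski ?X) T \<and> x \<in> T \<and> T \<subseteq> {x \<in> V. h x \<noteq> 0}" by blast
  qed
  show "(\<lambda>x. inverse (h x)) \<in> reg ?X {x \<in> V. h x \<noteq> 0}"
  proof (rule patches_regI)
    fix x assume "x \<in> {x \<in> V. h x \<noteq> 0}"
    then have x: "x \<in> V" "h x \<noteq> 0" by auto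
    obtain V1 A1 a b where 1: "(V1, A1) \<in> P" "a \<in> A1" "b \<in> A1" "x \<in> V1" "b x \<noteq> 0"
      "\<And>y. y \<in> V1 \<Longrightarrow> b y \<noteq> 0 \<Longrightarrow> y \<in> V \<and> h y = a y / b y"
      by (rule patches_reg_nbhdE[OF *(2,1) x(1)]) (rule that)
    then have "a x \<noteq> 0" using x by auto
    \<comment> \<open>The inverse of \<open>a / b\<close> is written with numerator
      \<open>b * b\<close> and denominator \<open>a * b\<close>, so that a nonzero denominator also
      keeps \<open>b\<close> away from zero.\<close>
    with 1 show "\<exists>V' A g k. (V', A) \<in> P \<and> g \<in> A \<and> k \<in> A \<and> x \<in> V' \<and> k x \<noteq> 0 \<and>
        (\<forall>y\<in>{x \<in> V. h x \<noteq> 0} \<inter> V'. k y \<noteq> 0 \<longrightarrow> inverse (h y) = g y / k y)"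
      by - (rule exI[of _ V1], rule exI[of _ A1], rule exI[of _ "\<lambda>y. b y * b y"], rule exI[of _ "\<lambda>y. a y * b y"], (auto intro: patch_mult))
  qed
qed

end

section \<open>Affine sets, products and varieties as function spaces\<close>

lemma directed_patches_single:
  "generated_algebra \<rat> A \<subseteq> A \<Longrightarrow> directed_patches {(V, A)}"
  unfolding directed_patches_def by auto

text \<open>Two rectangles meet in a rectangle, and restricting regular functions to its sides makes
  the algebra there contain both given ones.\<close>

lemma directed_patches_prod:
  assumes "function_space X" "function_space Y"
  shows "directed_patches
     {(V \<times> W, generated_algebra \<rat> ((\<lambda>a. a \<circ> fst) ` reg X V \<union> (\<lambda>b. b \<circ> snd) ` reg Y W)) | V W.
        openin (zariski X) V \<and> openin (zariski Y) W}" (is "directed_patches ?P")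
  unfolding directed_patches_def
proof (intro conjI allI impI)
  fix V A assume "(V, A) \<in> ?P"
  then show "generated_algebra \<rat> A \<subseteq> A" using generated_algebra_idem by fastforce
next
  fix V A V' A' x assume "(V, A) \<in> ?P \<and> (V', A') \<in> ?P \<and> x \<in> V \<inter> V'"
  then obtain V1 W1 V2 W2 where
    1: "V = V1 \<times> W1" "A = generated_algebra \<rat> ((\<lambda>a. a \<circ> fst) ` reg X V1 \<union> (\<lambda>b. b \<circ> snd) ` reg Y W1)"
       "openin (zariski X) V1" "openin (zariski Y) W1" and
    2: "V' = V2 \<times> W2" "A' = generated_algebra \<rat> ((\<lambda>a. a \<circ> fst) ` reg X V2 \<union> (\<lambda>b. b \<circ> snd) ` reg Y W2)"
       "openin (zariski X) V2" "openin (zariski Y) W2" and x: "x \<in> V \<inter> V'"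
    by blast
  let ?A = "generated_algebra \<rat>
    ((\<lambda>a. a \<circ> fst) ` reg X (V1 \<inter> V2) \<union> (\<lambda>b. b \<circ> snd) ` reg Y (W1 \<inter> W2))"
  have "reg X V1 \<union> reg X V2 \<subseteq> reg X (V1 \<inter> V2)"
    using function_space.regular_restrict[OF assms(1)] 1 2 by (metis Un_least inf.cobounded1 inf.cobounded2 openin_Int subsetI)
  moreover have "reg Y W1 \<union> reg Y W2 \<subseteq> reg Y (W1 \<inter> W2)"
    using function_space.regular_restrict[OF assms(2)] 1 2 by (metis Un_least inf.cobounded1 inf.cobounded2 openin_Int subsetI)
  ultimately have "A \<subseteq> ?A" "A' \<subseteq> ?A"
    unfolding 1(2) 2(2) by (intro generated_algebra_mono; auto)+
  moreover have "((V1 \<inter> V2) \<times> (W1 \<inter> W2), ?A) \<in> ?P" using 1 2 by blast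
  moreover have "x \<in> (V1 \<inter> V2) \<times> (W1 \<inter> W2)" "(V1 \<inter> V2) \<times> (W1 \<inter> W2) \<subseteq> V \<inter> V'"
    using x 1 2 by auto
  ultimately show "\<exists>V'' A''. (V'', A'') \<in> ?P \<and> x \<in> V'' \<and> V'' \<subseteq> V \<inter> V' \<and> A \<union> A' \<subseteq> A''"
    by blast
qed

lemma function_space_prod:
  "function_space X \<Longrightarrow> function_space Y \<Longrightarrow> function_space (X \<otimes>\<^sub>v Y)"
  unfolding prod_fspace_def by (intro function_space_patches directed_patches_prod)

lemma topspace_prod:
  assumes "function_space X" "function_space Y"
  shows "topspace (zariski (X \<otimes>\<^sub>v Y)) = topspace (zariski X) \<times> topspace (zariski Y)"
proof -
  let ?A = "\<lambda>V W. generated_algebra \<rat> ((\<lambda>a. a \<circ> fst) ` reg X V \<union> (\<lambda>b. b \<circ> snd) ` reg Y W)"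
  let ?P = "{(V \<times> W, ?A V W) | V W. openin (zariski X) V \<and> openin (zariski Y) W}"
  have "V \<times> W \<subseteq> topspace (zariski X) \<times> topspace (zariski Y)"
    if "openin (zariski X) V" "openin (zariski Y) W" for V W
    using openin_subset[OF that(1)] openin_subset[OF that(2)] by (rule Sigma_mono)
  then have "(\<Union>(V, A)\<in>?P. V) \<subseteq> topspace (zariski X) \<times> topspace (zariski Y)"
    by (intro UN_least) auto
  moreover have "(topspace (zariski X) \<times> topspace (zariski Y),
      ?A (topspace (zariski X)) (topspace (zariski Y))) \<in> ?P"
    by (rule CollectI, rule exI[of _ "topspace (zariski X)"], rule exI[of _ "topspace (zariski Y)"]) simp
  then have "topspace (zariski X) \<times> topspace (zariski Y) \<subseteq> (\<Union>(V, A)\<in>?P. V)"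
    by (rule SUP_upper2) simp
  ultimately show ?thesis
    unfolding prod_fspace_def topspace_patches[OF directed_patches_prod[OF assms]] by (rule antisym)
qed

lemma function_space_affine: "function_space (affine_fspace \<rat> C Z)"
  unfolding affine_fspace_def
  by (intro function_space_patches directed_patches_single generated_algebra_idem)

lemma topspace_affine: "topspace (zariski (affine_fspace \<rat> C Z)) = Z"
  unfolding affine_fspace_def
  by (subst topspace_patches[OF directed_patches_single[OF generated_algebra_idem]]) simp

text \<open>The sheaf property is part of \<open>variety\<close>. Invertibility is local, so it is
  read off on an affine chart, where it holds by the construction from quotients, and is carried
  back by the chart isomorphism.\<close>

lemma function_space_variety:
  assumes "variety X"
  shows "function_space X"
proof
  show sheaf: "sheaf_of_functions X" using assms by (simp add: variety_def)
  obtain \<V> where \<V>: "\<Union>\<V> = topspace (zariski X)"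
    "\<And>V. V \<in> \<V> \<Longrightarrow> openin (zariski X) V \<and> affine_variety (open_subspace X V)"
    using assms unfolding variety_def by blast
  fix W h assume W: "openin (zariski X) W" and h: "h \<in> reg X W"
  \<comment> \<open>Both remaining axioms follow from this local claim, the first by taking unions
    and the second by gluing.\<close>
  have *: "\<exists>V. openin (zariski X) V \<and> x \<in> V \<and> V \<subseteq> {x \<in> W. h x \<noteq> 0} \<and>
      (\<exists>g\<in>reg X V. \<forall>y\<in>V. inverse (h y) = g y)" if x: "x \<in> W" "h x \<noteq> 0" for x
  proof -
    obtain V where V: "V \<in> \<V>" "x \<in> V" using x W \<V>(1) openin_subset by blast
    then have oV: "openin (zariski X) V" using \<V> by blast
    then have tV: "topspace (zariski (open_subspace X V)) = V"
      by (simp add: open_subspace_def topspace_subtopology inf.absorb2 openin_subset)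
    have oe: "openin (zariski (open_subspace X V)) S \<longleftrightarrow> openin (zariski X) S \<and> S \<subseteq> V" for S
      by (simp add: open_subspace_def openin_open_subtopology oV)
    have re: "reg (open_subspace X V) = reg X" by (simp add: open_subspace_def)
    obtain m Z f where iso: "fspace_iso (open_subspace X V) (affine_fspace \<rat> (coordinates m) Z) f"
      using \<V> V unfolding affine_variety_def by blast
    let ?Y = "affine_fspace \<rat> (coordinates m) Z"
    let ?i = "inv_into V f"
    interpret Y: function_space ?Y by (rule function_space_affine)
    have bij: "bij_betw f V Z" and f: "regular_on (open_subspace X V) V f ?Y"
      and i: "regular_on ?Y Z ?i (open_subspace X V)"
      using iso unfolding fspace_iso_def tV topspace_affine by auto
    have if_[simp]: "?i (f y) = y" if "y \<in> V" for y
      using bij that by (simp add: bij_betw_def)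
    have WV: "openin (zariski X) (W \<inter> V)" using W oV by blast
    have "h \<in> reg X (W \<inter> V)"
      using sheaf W WV h unfolding sheaf_of_functions_def by blast
    then have S: "openin (zariski ?Y) (Z \<inter> ?i -` (W \<inter> V))"
      and hi: "h \<circ> ?i \<in> reg ?Y (Z \<inter> ?i -` (W \<inter> V))"
      using i WV unfolding regular_on_def oe re by auto
    define S' where "S' = {y \<in> Z \<inter> ?i -` (W \<inter> V). (h \<circ> ?i) y \<noteq> 0}"
    have S': "openin (zariski ?Y) S'" "(\<lambda>y. inverse ((h \<circ> ?i) y)) \<in> reg ?Y S'"
      unfolding S'_def using Y.openin_nonvanishing[OF S hi] Y.inverse_regular[OF S hi] by auto
    have "f y \<in> Z" if "y \<in> V" for y using bij that by (rule bij_betw_apply)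
    then have "V \<inter> f -` S' = {x \<in> W \<inter> V. h x \<noteq> 0}"
      unfolding S'_def by auto
    moreover have "openin (zariski X) (V \<inter> f -` S')"
      "(\<lambda>y. inverse ((h \<circ> ?i) y)) \<circ> f \<in> reg X (V \<inter> f -` S')"
      using f S' unfolding regular_on_def oe re by auto
    ultimately show ?thesis
      using x V by (intro exI[of _ "V \<inter> f -` S'"] conjI bexI[of _ "(\<lambda>y. inverse ((h \<circ> ?i) y)) \<circ> f"]) auto
  qed
  show op: "openin (zariski X) {x \<in> W. h x \<noteq> 0}"
    by (subst openin_subopen) (use * in blast)
  show "(\<lambda>x. inverse (h x)) \<in> reg X {x \<in> W. h x \<noteq> 0}"
  proof -
    have "\<forall>x\<in>{x \<in> W. h x \<noteq> 0}. \<exists>V. openin (zariski X) V \<and> x \<in> V \<and> V \<subseteq> {x \<in> W. h x \<noteq> 0} \<and>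
      (\<exists>g\<in>reg X V. \<forall>y\<in>V. inverse (h y) = g y)"
      by (intro ballI *) auto
    then show ?thesis
      by (rule sheaf[unfolded sheaf_of_functions_def, THEN conjunct2, THEN conjunct2,
        rule_format, OF conjI[OF op]])
  qed
qed

section \<open>Regular and partially defined maps\<close>

lemma (in function_space) regular_on_cong:
  assumes "regular_on X W f Y" and eq: "\<And>x. x \<in> W \<Longrightarrow> f x = g x"
  shows "regular_on X W g Y"
proof -
  have *: "W \<inter> g -` V = W \<inter> f -` V" for V using eq by auto
  have "h \<circ> g \<in> reg X (W \<inter> f -` V)"
    if "openin (zariski X) (W \<inter> f -` V)" "h \<circ> f \<in> reg X (W \<inter> f -` V)" for V h
    using that by (rule regular_cong) (simp add: eq)
  moreover have "g ` W = f ` W" using eq by auto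
  ultimately show ?thesis using assms(1) unfolding regular_on_def * by simp
qed

text \<open>Patches suffice as test objects: the locus where \<open>k\<close> is nonzero pulls back
  to the locus where the regular function \<open>k \<circ> f\<close> is nonzero, and a quotient
  \<open>g / k\<close> pulls back to a quotient of regular functions.\<close>

lemma regular_on_patches:
  assumes "function_space X" and P: "directed_patches P"
    and W: "openin (zariski X) W" and img: "f ` W \<subseteq> (\<Union>(V, A)\<in>P. V)"
    and op: "\<And>V A. (V, A) \<in> P \<Longrightarrow> openin (zariski X) (W \<inter> f -` V)"
    and reg: "\<And>V A a. (V, A) \<in> P \<Longrightarrow> a \<in> A \<Longrightarrow> a \<circ> f \<in> reg X (W \<inter> f -` V)"
  shows "regular_on X W f (fspace_of_patches P)"
proof -
  interpret X: function_space X by fact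
  let ?Y = "fspace_of_patches P"
  have nv: "openin (zariski X) {z \<in> W \<inter> f -` V. (k \<circ> f) z \<noteq> 0}" if "(V, A) \<in> P" "k \<in> A" for V A k
    by (rule X.openin_nonvanishing[OF op[OF that(1)] reg[OF that]])
  have 1: "openin (zariski X) (W \<inter> f -` S)" if S: "openin (zariski ?Y) S" for S
  proof (subst openin_subopen, intro ballI)
    fix x assume x: "x \<in> W \<inter> f -` S"
    then have "f x \<in> S" by simp
    obtain V A h where V: "(V, A) \<in> P" "h \<in> A" "f x \<in> V" "h (f x) \<noteq> 0" "{y \<in> V. h y \<noteq> 0} \<subseteq> S"
      by (rule patches_basis[OF P S \<open>f x \<in> S\<close>]) (rule that)
    then show "\<exists>T. openin (zariski X) T \<and> x \<in> T \<and> T \<subseteq> W \<inter> f -` S"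
      using x nv[OF V(1,2)] by (intro exI[of _ "{z \<in> W \<inter> f -` V. (h \<circ> f) z \<noteq> 0}"]) auto
  qed
  have 2: "h \<circ> f \<in> reg X (W \<inter> f -` S)" if S: "openin (zariski ?Y) S" and h: "h \<in> reg ?Y S" for S h
  proof (rule X.regular_local[OF 1[OF S]])
    fix x assume x: "x \<in> W \<inter> f -` S"
    then have "f x \<in> S" by simp
    obtain V A g k where V: "(V, A) \<in> P" "g \<in> A" "k \<in> A" "f x \<in> V" "k (f x) \<noteq> 0"
      "\<And>y. y \<in> V \<Longrightarrow> k y \<noteq> 0 \<Longrightarrow> y \<in> S \<and> h y = g y / k y"
      by (rule patches_reg_nbhdE[OF P h S \<open>f x \<in> S\<close>]) (rule that)
    let ?O = "{z \<in> W \<inter> f -` V. (k \<circ> f) z \<noteq> 0}"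
    have O: "openin (zariski X) ?O" by (rule nv[OF V(1,3)])
    have "g \<circ> f \<in> reg X ?O"
      by (rule X.regular_restrict[OF op[OF V(1)] O _ reg[OF V(1,2)]]) blast
    moreover have "(\<lambda>z. inverse ((k \<circ> f) z)) \<in> reg X ?O"
      by (rule X.inverse_regular[OF op[OF V(1)] reg[OF V(1,3)]])
    ultimately have "(\<lambda>z. (g \<circ> f) z * inverse ((k \<circ> f) z)) \<in> reg X ?O"
      by (rule X.regular_mult[OF O])
    moreover have "?O \<subseteq> W \<inter> f -` S" using V(6) by auto
    moreover have "\<forall>z\<in>?O. (h \<circ> f) z = (g \<circ> f) z * inverse ((k \<circ> f) z)"
      using V(6) by (auto simp: divide_inverse)
    moreover have "x \<in> ?O" using x V(4,5) by auto
    ultimately show "\<exists>V g. openin (zariski X) V \<and> x \<in> V \<and> V \<subseteq> W \<inter> f -` S \<and> g \<in> reg X V \<and>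
        (\<forall>y\<in>V. (h \<circ> f) y = g y)"
      using O by - (rule exI[of _ ?O], rule exI[of _ "\<lambda>z. (g \<circ> f) z * inverse ((k \<circ> f) z)"], intro conjI)
  qed
  have "f ` W \<subseteq> topspace (zariski ?Y)"
    using img unfolding topspace_patches[OF P] .
  with W 1 2 show ?thesis unfolding regular_on_def by simp
qed

lemma regular_on_affine:
  assumes "function_space X" "openin (zariski X) W" "f ` W \<subseteq> Z"
    and "\<And>c. c \<in> C \<Longrightarrow> c \<circ> f \<in> reg X W"
  shows "regular_on X W f (affine_fspace \<rat> C Z)"
  unfolding affine_fspace_def
proof (rule regular_on_patches[OF assms(1) _ assms(2)])
  have *: "W \<inter> f -` Z = W" using assms(3) by blast
  show "directed_patches {(Z, generated_algebra \<rat> C)}"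
    by (intro directed_patches_single generated_algebra_idem)
  show "f ` W \<subseteq> (\<Union>(V, A)\<in>{(Z, generated_algebra \<rat> C)}. V)" using assms(3) by simp
  fix V A assume "(V, A) \<in> {(Z, generated_algebra \<rat> C)}"
  then have VA: "V = Z" "A = generated_algebra \<rat> C" by auto
  show "openin (zariski X) (W \<inter> f -` V)" unfolding VA * by fact
  fix a assume "a \<in> A"
  then have "a \<circ> f \<in> generated_algebra \<rat> (reg X W)"
    unfolding VA by (rule generated_algebra_comp) (intro generated_algebra.gen assms(4))
  then show "a \<circ> f \<in> reg X (W \<inter> f -` V)"
    unfolding VA * using function_space.regular_algebra[OF assms(1,2)] by simp
qed

lemma regular_on_openin:
  "regular_on X W f Y \<Longrightarrow> openin (zariski Y) V \<Longrightarrow> openin (zariski X) (W \<inter> f -` V)"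
  unfolding regular_on_def by simp

lemma regular_on_pullback:
  "regular_on X W f Y \<Longrightarrow> openin (zariski Y) V \<Longrightarrow> h \<in> reg Y V \<Longrightarrow> h \<circ> f \<in> reg X (W \<inter> f -` V)"
  unfolding regular_on_def by simp

lemma (in function_space) regular_on_restrict:
  assumes f: "regular_on X W f Y" and W': "openin (zariski X) W'" "W' \<subseteq> W"
  shows "regular_on X W' f Y"
proof -
  have 1: "openin (zariski X) (W' \<inter> f -` V)" if "openin (zariski Y) V" for V
  proof -
    have "W' \<inter> f -` V = W' \<inter> (W \<inter> f -` V)" using W' by blast
    then show ?thesis using W'(1) regular_on_openin[OF f that] by (simp only: openin_Int)
  qed
  have "h \<circ> f \<in> reg X (W' \<inter> f -` V)" if V: "openin (zariski Y) V" "h \<in> reg Y V" for V h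
    by (rule regular_restrict[OF regular_on_openin[OF f V(1)] 1[OF V(1)] _ regular_on_pullback[OF f V]])
      (use W'(2) in blast)
  moreover have "f ` W' \<subseteq> topspace (zariski Y)"
    using f W'(2) unfolding regular_on_def by (meson image_mono order_trans)
  ultimately show ?thesis using 1 W'(1) unfolding regular_on_def by simp
qed

lemma regular_on_compose:
  assumes f: "regular_on X W f Y" and g: "regular_on Y V g Z"
  shows "regular_on X (W \<inter> f -` V) (g \<circ> f) Z"
  unfolding regular_on_def
proof (intro conjI allI impI ballI)
  have V: "openin (zariski Y) V" using g by (simp add: regular_on_def)
  show "openin (zariski X) (W \<inter> f -` V)" by (rule regular_on_openin[OF f V])
  show "(g \<circ> f) ` (W \<inter> f -` V) \<subseteq> topspace (zariski Z)" using g by (auto simp: regular_on_def)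
  fix S assume S: "openin (zariski Z) S"
  have *: "W \<inter> f -` V \<inter> (g \<circ> f) -` S = W \<inter> f -` (V \<inter> g -` S)" by auto
  note gS = regular_on_openin[OF g S]
  show "openin (zariski X) (W \<inter> f -` V \<inter> (g \<circ> f) -` S)"
    unfolding * by (rule regular_on_openin[OF f gS])
  show "h \<circ> (g \<circ> f) \<in> reg X (W \<inter> f -` V \<inter> (g \<circ> f) -` S)" if "h \<in> reg Z S" for h
    unfolding * using regular_on_pullback[OF f gS regular_on_pullback[OF g S that]]
    by (simp only: comp_assoc)
qed

text \<open>This is the existence half of the universal property of the product. The patch algebra
  is generated by \<open>a \<circ> fst\<close> and \<open>b \<circ> snd\<close>, which pull back to
  \<open>a \<circ> f\<close> and \<open>b \<circ> g\<close>.\<close>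

lemma regular_on_pair:
  assumes fs: "function_space Z" "function_space X" "function_space Y"
    and f: "regular_on Z W f X" and g: "regular_on Z W g Y"
  shows "regular_on Z W (\<lambda>z. (f z, g z)) (X \<otimes>\<^sub>v Y)"
proof -
  interpret Z: function_space Z by fact
  let ?C = "\<lambda>V V'. (\<lambda>a. a \<circ> fst) ` reg X V \<union> (\<lambda>b. b \<circ> snd) ` reg Y V'"
  let ?P = "{(V \<times> V', generated_algebra \<rat> (?C V V')) | V V'. openin (zariski X) V \<and> openin (zariski Y) V'}"
  let ?fg = "\<lambda>z. (f z, g z)"
  have W: "openin (zariski Z) W" using f by (simp add: regular_on_def)
  have "regular_on Z W ?fg (fspace_of_patches ?P)"
  proof (rule regular_on_patches[OF fs(1) directed_patches_prod[OF fs(2,3)] W])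
    have "?fg ` W \<subseteq> topspace (zariski X) \<times> topspace (zariski Y)"
      using f g unfolding regular_on_def by auto
    also have "\<dots> = (\<Union>(V, A)\<in>?P. V)"
      using topspace_prod[OF fs(2,3)]
      unfolding prod_fspace_def topspace_patches[OF directed_patches_prod[OF fs(2,3)]] by (rule sym)
    finally show "?fg ` W \<subseteq> (\<Union>(V, A)\<in>?P. V)" .
  next
    fix V A assume "(V, A) \<in> ?P"
    then obtain V1 V2 where V: "V = V1 \<times> V2" "A = generated_algebra \<rat> (?C V1 V2)"
      "openin (zariski X) V1" "openin (zariski Y) V2" by blast
    have *: "W \<inter> ?fg -` V = (W \<inter> f -` V1) \<inter> (W \<inter> g -` V2)" unfolding V(1) by auto
    show op: "openin (zariski Z) (W \<inter> ?fg -` V)"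
      unfolding * by (intro openin_Int regular_on_openin[OF f V(3)] regular_on_openin[OF g V(4)])
    have "a \<circ> f \<in> reg Z (W \<inter> ?fg -` V)" if "a \<in> reg X V1" for a
      by (rule Z.regular_restrict[OF regular_on_openin[OF f V(3)] op _ regular_on_pullback[OF f V(3) that]])
        (unfold *, rule Int_lower1)
    moreover have "b \<circ> g \<in> reg Z (W \<inter> ?fg -` V)" if "b \<in> reg Y V2" for b
      by (rule Z.regular_restrict[OF regular_on_openin[OF g V(4)] op _ regular_on_pullback[OF g V(4) that]])
        (unfold *, rule Int_lower2)
    ultimately have C: "c \<circ> ?fg \<in> reg Z (W \<inter> ?fg -` V)" if "c \<in> ?C V1 V2" for c
      using that by (auto simp: o_def)
    fix a assume "a \<in> A"
    then have "a \<circ> ?fg \<in> generated_algebra \<rat> (reg Z (W \<inter> ?fg -` V))"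
      unfolding V(2) by (rule generated_algebra_comp) (intro generated_algebra.gen C)
    then show "a \<circ> ?fg \<in> reg Z (W \<inter> ?fg -` V)" by (rule Z.regular_algebra[OF op])
  qed
  then show ?thesis unfolding prod_fspace_def .
qed

lemma
  assumes fs: "function_space X" "function_space Y"
  shows regular_on_fst: "regular_on (X \<otimes>\<^sub>v Y) (topspace (zariski (X \<otimes>\<^sub>v Y))) fst X"
    and regular_on_snd: "regular_on (X \<otimes>\<^sub>v Y) (topspace (zariski (X \<otimes>\<^sub>v Y))) snd Y"
proof -
  let ?T = "topspace (zariski (X \<otimes>\<^sub>v Y))"
  let ?A = "\<lambda>V W. generated_algebra \<rat> ((\<lambda>a. a \<circ> fst) ` reg X V \<union> (\<lambda>b. b \<circ> snd) ` reg Y W)"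
  let ?P = "{(V \<times> W, ?A V W) | V W. openin (zariski X) V \<and> openin (zariski Y) W}"
  have patch: "openin (zariski (X \<otimes>\<^sub>v Y)) (V \<times> W)" "?A V W \<subseteq> reg (X \<otimes>\<^sub>v Y) (V \<times> W)"
    if "openin (zariski X) V" "openin (zariski Y) W" for V W
  proof -
    have P: "(V \<times> W, ?A V W) \<in> ?P"
      by (rule CollectI, rule exI[of _ V], rule exI[of _ W]) (use that in simp)
    show "openin (zariski (X \<otimes>\<^sub>v Y)) (V \<times> W)"
      unfolding prod_fspace_def by (rule openin_patch[OF directed_patches_prod[OF fs] P])
    show "?A V W \<subseteq> reg (X \<otimes>\<^sub>v Y) (V \<times> W)"
      unfolding prod_fspace_def by (rule patch_subset_reg[OF directed_patches_prod[OF fs] P])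
  qed
  have fst: "?T \<inter> fst -` V = V \<times> topspace (zariski Y)" if "openin (zariski X) V" for V
    using openin_subset[OF that] by (auto simp: topspace_prod[OF fs])
  have snd: "?T \<inter> snd -` V = topspace (zariski X) \<times> V" if "openin (zariski Y) V" for V
    using openin_subset[OF that] by (auto simp: topspace_prod[OF fs])
  have 1: "h \<circ> fst \<in> reg (X \<otimes>\<^sub>v Y) (V \<times> topspace (zariski Y))"
    if "openin (zariski X) V" "h \<in> reg X V" for V h
    by (rule subsetD[OF patch(2)[OF that(1) openin_topspace]], rule generated_algebra.gen) (use that(2) in blast)
  have 2: "h \<circ> snd \<in> reg (X \<otimes>\<^sub>v Y) (topspace (zariski X) \<times> V)"
    if "openin (zariski Y) V" "h \<in> reg Y V" for V h
    by (rule subsetD[OF patch(2)[OF openin_topspace that(1)]], rule generated_algebra.gen) (use that(2) in blast)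
  have "fst ` ?T \<subseteq> topspace (zariski X)" by (auto simp: topspace_prod[OF fs])
  then show "regular_on (X \<otimes>\<^sub>v Y) ?T fst X"
    unfolding regular_on_def using 1 patch(1)[OF _ openin_topspace] by (simp add: fst)
  have "snd ` ?T \<subseteq> topspace (zariski Y)" by (auto simp: topspace_prod[OF fs])
  then show "regular_on (X \<otimes>\<^sub>v Y) ?T snd Y"
    unfolding regular_on_def using 2 patch(1)[OF openin_topspace] by (simp add: snd)
qed

lemma regular_on_topspace_compose:
  assumes "regular_on X W f Y" "regular_on Y (topspace (zariski Y)) g Z"
  shows "regular_on X W (g \<circ> f) Z"
proof -
  have "W \<inter> f -` topspace (zariski Y) = W" using assms(1) unfolding regular_on_def by auto
  then show ?thesis using regular_on_compose[OF assms] by simp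
qed

text \<open>Both directions are pairings of composed projections, so the universal property suffices
  and the two iterated systems of patches are never compared.\<close>

lemma fspace_iso_reassoc:
  assumes fs: "function_space X" "function_space Y" "function_space Z"
  shows "fspace_iso ((X \<otimes>\<^sub>v Y) \<otimes>\<^sub>v Z) (X \<otimes>\<^sub>v Y \<otimes>\<^sub>v Z) reassoc"
proof -
  let ?L = "(X \<otimes>\<^sub>v Y) \<otimes>\<^sub>v Z" and ?R = "X \<otimes>\<^sub>v Y \<otimes>\<^sub>v Z"
  let ?TL = "topspace (zariski ?L)" and ?TR = "topspace (zariski ?R)"
  note fsp = fs function_space_prod
  interpret L: function_space ?L by (intro fsp)
  interpret R: function_space ?R by (intro fsp)
  note top = topspace_prod[OF fs(1,2)] topspace_prod[OF fs(2,3)]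
    topspace_prod[OF function_space_prod[OF fs(1,2)] fs(3)]
    topspace_prod[OF fs(1) function_space_prod[OF fs(2,3)]]
  have bij: "bij_betw reassoc ?TL ?TR"
    by (rule bij_betw_byWitness[of _ "\<lambda>(x, y, z). ((x, y), z)"]) (auto simp: reassoc_def top)
  have LR: "regular_on ?L ?TL reassoc ?R"
  proof -
    have a: "regular_on ?L ?TL fst (X \<otimes>\<^sub>v Y)" by (rule regular_on_fst) (intro fsp)+
    have b: "regular_on ?L ?TL snd Z" by (rule regular_on_snd) (intro fsp)+
    have "regular_on ?L ?TL (\<lambda>p. ((fst \<circ> fst) p, ((snd \<circ> fst) p, snd p))) ?R"
      by (intro regular_on_pair fsp b regular_on_topspace_compose[OF a] regular_on_fst regular_on_snd)
    then show ?thesis by (rule L.regular_on_cong) (simp add: reassoc_def split: prod.split)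
  qed
  have "regular_on ?R ?TR (\<lambda>p. ((fst p, (fst \<circ> snd) p), (snd \<circ> snd) p)) ?L"
  proof -
    have a: "regular_on ?R ?TR snd (Y \<otimes>\<^sub>v Z)" by (rule regular_on_snd) (intro fsp)+
    have b: "regular_on ?R ?TR fst X" by (rule regular_on_fst) (intro fsp)+
    show ?thesis
      by (intro regular_on_pair fsp b regular_on_topspace_compose[OF a] regular_on_fst regular_on_snd)
  qed
  \<comment> \<open>\<open>fspace_iso\<close> speaks of \<open>inv_into\<close>, which agrees on the
    space with the explicit inverse just shown to be regular.\<close>
  then have "regular_on ?R ?TR (inv_into ?TL reassoc) ?L"
  proof (rule R.regular_on_cong)
    fix p assume p: "p \<in> ?TR"
    let ?q = "((fst p, (fst \<circ> snd) p), (snd \<circ> snd) p)"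
    have "?q \<in> ?TL" "reassoc ?q = p" using p by (auto simp: top reassoc_def)
    then show "?q = inv_into ?TL reassoc p"
      using inv_into_f_f[OF bij_betw_imp_inj_on[OF bij]] by metis
  qed
  with bij LR show ?thesis unfolding fspace_iso_def by blast
qed

text \<open>The regularity half of \<open>rational_map\<close>, split off from density because it
  survives every composition, whereas a composite of rational maps may have an empty domain.\<close>

definition regular_partial :: "'a fspace \<Rightarrow> 'b fspace \<Rightarrow> ('a \<rightharpoonup> 'b) \<Rightarrow> bool" where
  "regular_partial X Y f \<longleftrightarrow> regular_on X (dom f) (\<lambda>x. the (f x)) Y"

lemma regular_partial_dom: "regular_partial X Y f \<Longrightarrow> openin (zariski X) (dom f)"
  by (simp add: regular_partial_def regular_on_def)

lemma regular_partial_dom_topspace: "regular_partial X Y f \<Longrightarrow> f x = Some y \<Longrightarrow> x \<in> topspace (zariski X)"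
  using openin_subset[OF regular_partial_dom] by blast

lemma regular_partial_range_topspace: "regular_partial X Y f \<Longrightarrow> f x = Some y \<Longrightarrow> y \<in> topspace (zariski Y)"
  unfolding regular_partial_def regular_on_def image_subset_iff by (metis domI option.sel)

text \<open>Projections and matrix multiplication are total in HOL. They enter composites of partial
  maps in this guarded form, undefined off \<open>W\<close>.\<close>

lemma regular_partial_Some:
  assumes "function_space X" "regular_on X W f Y"
  shows "regular_partial X Y (\<lambda>x. if x \<in> W then Some (f x) else None)"
proof -
  have "dom (\<lambda>x. if x \<in> W then Some (f x) else None) = W" by (auto split: if_splits)
  then show ?thesis
    unfolding regular_partial_def
    using function_space.regular_on_cong[OF assms] by simp
qed

lemma regular_partial_bind:
  assumes "function_space X" and f: "regular_partial X Y f" and g: "regular_partial Y Z g"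
  shows "regular_partial X Z (\<lambda>x. Option.bind (f x) g)"
proof -
  have dom: "dom (\<lambda>x. Option.bind (f x) g) = dom f \<inter> (\<lambda>x. the (f x)) -` dom g"
    by (force simp: Option.bind_eq_Some_conv)
  have "regular_on X (dom f \<inter> (\<lambda>x. the (f x)) -` dom g) ((\<lambda>y. the (g y)) \<circ> (\<lambda>x. the (f x))) Z"
    using f g unfolding regular_partial_def by (rule regular_on_compose)
  then show ?thesis
    unfolding regular_partial_def dom
    by (rule function_space.regular_on_cong[OF assms(1)]) auto
qed

lemma regular_partial_pair:
  assumes fs: "function_space Z" "function_space X" "function_space Y"
    and f: "regular_partial Z X f" and g: "regular_partial Z Y g"
  shows "regular_partial Z (X \<otimes>\<^sub>v Y) (\<lambda>z. do { x \<leftarrow> f z; y \<leftarrow> g z; Some (x, y) })" (is "regular_partial _ _ ?h")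
proof -
  have dom: "dom ?h = dom f \<inter> dom g"
    by (force simp: Option.bind_eq_Some_conv)
  have op: "openin (zariski Z) (dom f \<inter> dom g)"
    by (intro openin_Int regular_partial_dom[OF f] regular_partial_dom[OF g])
  have "regular_on Z (dom f \<inter> dom g) (\<lambda>z. (the (f z), the (g z))) (X \<otimes>\<^sub>v Y)"
    using f g unfolding regular_partial_def
    by (intro regular_on_pair fs function_space.regular_on_restrict[OF fs(1) _ op]; assumption?) blast+
  then show ?thesis
    unfolding regular_partial_def dom
    by (rule function_space.regular_on_cong[OF fs(1)]) auto
qed

section \<open>The complex Zariski topology\<close>

lemma openin_complex_nonvanishing:
  "openin (zariski X) V \<Longrightarrow> h \<in> generated_algebra UNIV (reg X V) \<Longrightarrow>
   openin (complex_top X) {y \<in> V. h y \<noteq> 0}"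
  unfolding complex_top_def by (rule topology_generated_by_Basis) auto

lemma openin_complex_zariski: "openin (zariski X) V \<Longrightarrow> openin (complex_top X) V"
  using openin_complex_nonvanishing[of X V "\<lambda>_. 1"] generated_algebra.const[of 1 UNIV "reg X V"] by simp

lemma topspace_complex_top: "topspace (complex_top X) = topspace (zariski X)"
proof
  show "topspace (complex_top X) \<subseteq> topspace (zariski X)"
    using openin_subset by (fastforce simp: complex_top_def)
  show "topspace (zariski X) \<subseteq> topspace (complex_top X)"
    by (intro openin_subset openin_complex_zariski openin_topspace)
qed

lemma closure_of_complex_top_iff:
  "complex_top X closure_of D = topspace (zariski X) \<longleftrightarrow>
   (\<forall>S. openin (complex_top X) S \<and> S \<noteq> {} \<longrightarrow> D \<inter> S \<noteq> {})"
  using dense_intersects_open[of "complex_top X" D] by (simp add: topspace_complex_top)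

lemma (in function_space) openin_complex_top_basis:
  assumes "openin (complex_top X) S" "x \<in> S"
  obtains V h where "openin (zariski X) V" "h \<in> generated_algebra UNIV (reg X V)" "x \<in> V" "h x \<noteq> 0"
    "{y \<in> V. h y \<noteq> 0} \<subseteq> S"
proof -
  let ?B = "{{y \<in> V. h y \<noteq> 0} | V h. openin (zariski X) V \<and> h \<in> generated_algebra UNIV (reg X V)}"
  have "\<exists>B\<in>?B. x \<in> B \<and> B \<subseteq> S"
  proof (rule openin_generated_basis)
    show "openin (topology_generated_by ?B) S" using assms(1) by (simp add: complex_top_def)
    fix B C x assume "B \<in> ?B" "C \<in> ?B" "x \<in> B" "x \<in> C"
    then obtain V h V' h' where *: "openin (zariski X) V" "h \<in> generated_algebra UNIV (reg X V)"
      "B = {y \<in> V. h y \<noteq> 0}" "openin (zariski X) V'" "h' \<in> generated_algebra UNIV (reg X V')"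
      "C = {y \<in> V'. h' y \<noteq> 0}" by auto
    have VV: "openin (zariski X) (V \<inter> V')" using *(1,4) by (rule openin_Int)
    have "reg X V \<subseteq> reg X (V \<inter> V')" "reg X V' \<subseteq> reg X (V \<inter> V')"
      using regular_restrict[OF *(1) VV] regular_restrict[OF *(4) VV] by blast+
    then have "h \<in> generated_algebra UNIV (reg X (V \<inter> V'))" "h' \<in> generated_algebra UNIV (reg X (V \<inter> V'))"
      using *(2,5) generated_algebra_mono[OF subset_refl] by (meson subsetD)+
    then have "(\<lambda>y. h y * h' y) \<in> generated_algebra UNIV (reg X (V \<inter> V'))"
      by (rule generated_algebra.mult)
    then have "{y \<in> V \<inter> V'. h y * h' y \<noteq> 0} \<in> ?B"
      using VV by (intro CollectI exI[of _ "V \<inter> V'"] exI[of _ "\<lambda>y. h y * h' y"]) simp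
    moreover have "{y \<in> V \<inter> V'. h y * h' y \<noteq> 0} = B \<inter> C" unfolding *(3,6) by auto
    ultimately show "\<exists>D\<in>?B. x \<in> D \<and> D \<subseteq> B \<inter> C"
      using \<open>x \<in> B\<close> \<open>x \<in> C\<close> by (intro bexI[of _ "B \<inter> C"]) auto
  qed (fact assms(2))
  then obtain V h where "openin (zariski X) V" "h \<in> generated_algebra UNIV (reg X V)"
    "x \<in> {y \<in> V. h y \<noteq> 0}" "{y \<in> V. h y \<noteq> 0} \<subseteq> S"
    by auto
  then show ?thesis using that by simp
qed

text \<open>Pulling back is compatible with complex linear combinations, so a morphism over the
  rationals stays continuous after base change.\<close>

lemma regular_on_complex_openin:
  assumes "function_space Y" and f: "regular_on X W f Y" and S: "openin (complex_top Y) S"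
  shows "openin (complex_top X) (W \<inter> f -` S)"
proof (subst openin_subopen, intro ballI)
  fix x assume x: "x \<in> W \<inter> f -` S"
  then have "f x \<in> S" by simp
  obtain V h where V: "openin (zariski Y) V" "h \<in> generated_algebra UNIV (reg Y V)" "f x \<in> V"
    "h (f x) \<noteq> 0" "{y \<in> V. h y \<noteq> 0} \<subseteq> S"
    by (rule function_space.openin_complex_top_basis[OF assms(1) S \<open>f x \<in> S\<close>]) (rule that)
  have "h \<circ> f \<in> generated_algebra UNIV (reg X (W \<inter> f -` V))"
    using V(2) by (rule generated_algebra_comp) (intro generated_algebra.gen regular_on_pullback[OF f V(1)])
  then have "openin (complex_top X) {y \<in> W \<inter> f -` V. (h \<circ> f) y \<noteq> 0}"
    by (rule openin_complex_nonvanishing[OF regular_on_openin[OF f V(1)]])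
  moreover have "{y \<in> W \<inter> f -` V. (h \<circ> f) y \<noteq> 0} \<subseteq> W \<inter> f -` S" using V(5) by auto
  moreover have "x \<in> {y \<in> W \<inter> f -` V. (h \<circ> f) y \<noteq> 0}" using x V(3,4) by auto
  ultimately show "\<exists>T. openin (complex_top X) T \<and> x \<in> T \<and> T \<subseteq> W \<inter> f -` S" by blast
qed

lemma regular_partial_complex_openin:
  assumes "function_space Y" "regular_partial X Y f" "openin (complex_top Y) S"
  shows "openin (complex_top X) {x. \<exists>y\<in>S. f x = Some y}"
proof -
  have "{x. \<exists>y\<in>S. f x = Some y} = dom f \<inter> (\<lambda>x. the (f x)) -` S" by force
  then show ?thesis
    using regular_on_complex_openin[OF assms(1) assms(2)[unfolded regular_partial_def] assms(3)] by simp
qed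

section \<open>The complex Zariski topology in terms of patches\<close>

context
  fixes P :: "('a set \<times> ('a \<Rightarrow> complex) set) set"
  assumes P: "directed_patches P"
begin

text \<open>Denominators are cleared by induction over the complex algebra. Only the numerator
  acquires complex coefficients; the denominator stays in the rational algebra \<open>A\<close>, so
  its nonvanishing locus still lies inside \<open>W\<close>.\<close>

lemma patches_complex_quotient:
  assumes "h \<in> generated_algebra UNIV (reg (fspace_of_patches P) W)"
    and W: "openin (zariski (fspace_of_patches P)) W" and x: "x \<in> W"
  shows "\<exists>V A g k. (V, A) \<in> P \<and> g \<in> generated_algebra UNIV A \<and> k \<in> A \<and> x \<in> V \<and> k x \<noteq> 0 \<and>
    (\<forall>y\<in>V. k y \<noteq> 0 \<longrightarrow> y \<in> W \<and> h y = g y / k y)"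
  using assms(1)
proof induction
  case (const c)
  obtain V A k where V: "(V, A) \<in> P" "k \<in> A" "x \<in> V" "k x \<noteq> 0" "{y \<in> V. k y \<noteq> 0} \<subseteq> W"
    by (rule patches_basis[OF P W x]) (rule that)
  \<comment> \<open>Even a constant needs a denominator, since the claim also demands that the locus
    where the denominator is nonzero lie in \<open>W\<close>. Hence it is written as
    \<open>c * k\<close> over \<open>k\<close>.\<close>
  have "(\<lambda>y. c * k y) \<in> generated_algebra UNIV A"
    by (intro generated_algebra.mult generated_algebra.const generated_algebra.gen V(2) UNIV_I)
  with V show ?case
    by - (rule exI[of _ V], rule exI[of _ A], rule exI[of _ "\<lambda>y. c * k y"], rule exI[of _ k], auto)
next
  case (gen f)
  obtain V A g k where V: "(V, A) \<in> P" "g \<in> A" "k \<in> A" "x \<in> V" "k x \<noteq> 0"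
    "\<And>y. y \<in> V \<Longrightarrow> k y \<noteq> 0 \<Longrightarrow> y \<in> W \<and> f y = g y / k y"
    by (rule patches_reg_nbhdE[OF P gen W x]) (rule that)
  have "g \<in> generated_algebra UNIV A" using V(2) by (rule generated_algebra.gen)
  with V show ?case
    by - (rule exI[of _ V], rule exI[of _ A], rule exI[of _ g], rule exI[of _ k], simp)
next
  case (add f f')
  obtain V g k V' g' k' A A' where
    V: "(V, A) \<in> P" "g \<in> generated_algebra UNIV A" "k \<in> A" "x \<in> V" "k x \<noteq> 0"
      "\<forall>y\<in>V. k y \<noteq> 0 \<longrightarrow> y \<in> W \<and> f y = g y / k y" and
    V': "(V', A') \<in> P" "g' \<in> generated_algebra UNIV A'" "k' \<in> A'" "x \<in> V'" "k' x \<noteq> 0"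
      "\<forall>y\<in>V'. k' y \<noteq> 0 \<longrightarrow> y \<in> W \<and> f' y = g' y / k' y"
    using add.IH by (elim exE conjE) (rule that)
  obtain V'' A'' where V'': "(V'', A'') \<in> P" "x \<in> V''" "V'' \<subseteq> V" "V'' \<subseteq> V'" "A \<subseteq> A''" "A' \<subseteq> A''"
    by (rule patch_refine[OF P V(1) V'(1) V(4) V'(4)]) (rule that)
  have kk: "k \<in> A''" "k' \<in> A''" using V(3) V'(3) V''(5,6) by blast+
  have gg: "g \<in> generated_algebra UNIV A''" "g' \<in> generated_algebra UNIV A''"
    by (rule subsetD[OF generated_algebra_mono[OF subset_refl V''(5)] V(2)],
        rule subsetD[OF generated_algebra_mono[OF subset_refl V''(6)] V'(2)])
  have "(\<lambda>y. g y * k' y + g' y * k y) \<in> generated_algebra UNIV A''"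
    by (intro generated_algebra.mult generated_algebra.add gg generated_algebra.gen[OF kk(1)]
        generated_algebra.gen[OF kk(2)])
  moreover have "(\<lambda>y. k y * k' y) \<in> A''" by (rule patch_mult[OF P V''(1) kk])
  moreover have "\<forall>y\<in>V''. k y * k' y \<noteq> 0 \<longrightarrow>
      y \<in> W \<and> f y + f' y = (g y * k' y + g' y * k y) / (k y * k' y)"
  proof (intro ballI impI)
    fix y assume "y \<in> V''" and k: "k y * k' y \<noteq> 0"
    then have "y \<in> V" "y \<in> V'" "k y \<noteq> 0" "k' y \<noteq> 0" using V''(3,4) by auto
    then show "y \<in> W \<and> f y + f' y = (g y * k' y + g' y * k y) / (k y * k' y)"
      using V(6) V'(6) by (simp add: add_frac_eq)
  qed
  moreover have "k x * k' x \<noteq> 0" using V(5) V'(5) by simp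
  ultimately show ?case
    using V''(1,2) by - (rule exI[of _ V''], rule exI[of _ A''], rule exI[of _ "\<lambda>y. g y * k' y + g' y * k y"],
      rule exI[of _ "\<lambda>y. k y * k' y"], intro conjI)
next
  case (mult f f')
  obtain V g k V' g' k' A A' where
    V: "(V, A) \<in> P" "g \<in> generated_algebra UNIV A" "k \<in> A" "x \<in> V" "k x \<noteq> 0"
      "\<forall>y\<in>V. k y \<noteq> 0 \<longrightarrow> y \<in> W \<and> f y = g y / k y" and
    V': "(V', A') \<in> P" "g' \<in> generated_algebra UNIV A'" "k' \<in> A'" "x \<in> V'" "k' x \<noteq> 0"
      "\<forall>y\<in>V'. k' y \<noteq> 0 \<longrightarrow> y \<in> W \<and> f' y = g' y / k' y"
    using mult.IH by (elim exE conjE) (rule that)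
  obtain V'' A'' where V'': "(V'', A'') \<in> P" "x \<in> V''" "V'' \<subseteq> V" "V'' \<subseteq> V'" "A \<subseteq> A''" "A' \<subseteq> A''"
    by (rule patch_refine[OF P V(1) V'(1) V(4) V'(4)]) (rule that)
  have kk: "k \<in> A''" "k' \<in> A''" using V(3) V'(3) V''(5,6) by blast+
  have gg: "g \<in> generated_algebra UNIV A''" "g' \<in> generated_algebra UNIV A''"
    by (rule subsetD[OF generated_algebra_mono[OF subset_refl V''(5)] V(2)],
        rule subsetD[OF generated_algebra_mono[OF subset_refl V''(6)] V'(2)])
  have "(\<lambda>y. g y * g' y) \<in> generated_algebra UNIV A''"
    by (intro generated_algebra.mult gg)
  moreover have "(\<lambda>y. k y * k' y) \<in> A''" by (rule patch_mult[OF P V''(1) kk])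
  moreover have "\<forall>y\<in>V''. k y * k' y \<noteq> 0 \<longrightarrow> y \<in> W \<and> f y * f' y = (g y * g' y) / (k y * k' y)"
  proof (intro ballI impI)
    fix y assume "y \<in> V''" and k: "k y * k' y \<noteq> 0"
    then have "y \<in> V" "y \<in> V'" "k y \<noteq> 0" "k' y \<noteq> 0" using V''(3,4) by auto
    then show "y \<in> W \<and> f y * f' y = (g y * g' y) / (k y * k' y)"
      using V(6) V'(6) by simp
  qed
  moreover have "k x * k' x \<noteq> 0" using V(5) V'(5) by simp
  ultimately show ?case
    using V''(1,2) by - (rule exI[of _ V''], rule exI[of _ A''], rule exI[of _ "\<lambda>y. g y * g' y"],
      rule exI[of _ "\<lambda>y. k y * k' y"], intro conjI)
qed

text \<open>With the local form \<open>g / k\<close> at hand, the single function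
  \<open>g * k\<close> is nonzero exactly where the denominator and the quotient are. Near a point,
  a complex open set is thus described by the patch algebra alone.\<close>

lemma patches_complex_basis:
  assumes S: "openin (complex_top (fspace_of_patches P)) S" and x: "x \<in> S"
  obtains V A q where "(V, A) \<in> P" "q \<in> generated_algebra UNIV A" "x \<in> V" "q x \<noteq> 0"
    "{y \<in> V. q y \<noteq> 0} \<subseteq> S"
proof -
  obtain W h where W: "openin (zariski (fspace_of_patches P)) W"
    "h \<in> generated_algebra UNIV (reg (fspace_of_patches P) W)" "x \<in> W" "h x \<noteq> 0"
    "{y \<in> W. h y \<noteq> 0} \<subseteq> S"
    by (rule function_space.openin_complex_top_basis[OF function_space_patches[OF P] S x]) (rule that)
  obtain V A g k where V: "(V, A) \<in> P" "g \<in> generated_algebra UNIV A" "k \<in> A" "x \<in> V" "k x \<noteq> 0"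
    "\<forall>y\<in>V. k y \<noteq> 0 \<longrightarrow> y \<in> W \<and> h y = g y / k y"
    using patches_complex_quotient[OF W(2,1,3)] by (elim exE conjE) (rule that)
  show ?thesis
  proof (rule that[OF V(1)])
    show "(\<lambda>y. g y * k y) \<in> generated_algebra UNIV A"
      by (intro generated_algebra.mult V(2) generated_algebra.gen V(3))
    show "x \<in> V" by fact
    show "g x * k x \<noteq> 0" using V(4-6) W(4) by auto
    show "{y \<in> V. g y * k y \<noteq> 0} \<subseteq> S" using V(6) W(5) by auto
  qed
qed

end

text \<open>Fixing x in a finite sum of products a(x) b(y) leaves a combination of the b with
  coefficients a(x). These are arbitrary complex numbers, so the slice need not be open over the
  rationals, but it is open in \<open>complex_top\<close>.\<close>

lemma
  assumes fs: "function_space X" "function_space Y" and S: "openin (complex_top (X \<otimes>\<^sub>v Y)) S"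
  shows openin_complex_slice_left: "openin (complex_top Y) {y. (x, y) \<in> S}"
    and openin_complex_slice_right: "openin (complex_top X) {x. (x, y) \<in> S}"
proof -
  let ?C = "\<lambda>V W. (\<lambda>a. a \<circ> fst) ` reg X V \<union> (\<lambda>b. b \<circ> snd) ` reg Y W"
  have nbhd: "\<exists>V W q. openin (zariski X) V \<and> openin (zariski Y) W \<and> q \<in> generated_algebra UNIV (?C V W) \<and>
      x \<in> V \<and> y \<in> W \<and> q (x, y) \<noteq> 0 \<and> {p \<in> V \<times> W. q p \<noteq> 0} \<subseteq> S" if xy: "(x, y) \<in> S" for x y
  proof -
    obtain V A q where V: "(V, A) \<in> {(V \<times> W, generated_algebra \<rat> (?C V W)) | V W.
        openin (zariski X) V \<and> openin (zariski Y) W}"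
      "q \<in> generated_algebra UNIV A" "(x, y) \<in> V" "q (x, y) \<noteq> 0" "{y \<in> V. q y \<noteq> 0} \<subseteq> S"
      by (rule patches_complex_basis[OF directed_patches_prod[OF fs] S[unfolded prod_fspace_def] xy])
        (rule that)
    from V(1) obtain V1 V2 where V12: "V = V1 \<times> V2" "A = generated_algebra \<rat> (?C V1 V2)"
      "openin (zariski X) V1" "openin (zariski Y) V2" by blast
    have "A \<subseteq> generated_algebra UNIV (?C V1 V2)"
      unfolding V12(2) by (rule generated_algebra_mono) simp_all
    then have "q \<in> generated_algebra UNIV (generated_algebra UNIV (?C V1 V2))"
      by (rule subsetD[OF generated_algebra_mono[OF subset_refl] V(2)])
    then have "q \<in> generated_algebra UNIV (?C V1 V2)" by (rule subsetD[OF generated_algebra_idem])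
    with V(3-5) V12(3,4) show ?thesis
      unfolding V12(1) by - (rule exI[of _ V1], rule exI[of _ V2], rule exI[of _ q], simp)
  qed
  show "openin (complex_top Y) {y. (x, y) \<in> S}"
  proof (subst openin_subopen, intro ballI)
    fix y assume "y \<in> {y. (x, y) \<in> S}"
    then have xy: "(x, y) \<in> S" by simp
    obtain V W q where V: "openin (zariski X) V" "openin (zariski Y) W" "q \<in> generated_algebra UNIV (?C V W)"
      "x \<in> V" "y \<in> W" "q (x, y) \<noteq> 0" "{p \<in> V \<times> W. q p \<noteq> 0} \<subseteq> S"
      using nbhd[OF xy] by (elim exE conjE) (rule that)
    have "c \<circ> Pair x \<in> generated_algebra UNIV (reg Y W)" if "c \<in> ?C V W" for c
      using that generated_algebra.const[OF UNIV_I] generated_algebra.gen by (fastforce simp: o_def)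
    then have "q \<circ> Pair x \<in> generated_algebra UNIV (reg Y W)"
      by (rule generated_algebra_comp[OF V(3)])
    then have "openin (complex_top Y) {y \<in> W. (q \<circ> Pair x) y \<noteq> 0}"
      by (rule openin_complex_nonvanishing[OF V(2)])
    moreover have "y \<in> {y \<in> W. (q \<circ> Pair x) y \<noteq> 0}" using V(5,6) by simp
    moreover have "{y \<in> W. (q \<circ> Pair x) y \<noteq> 0} \<subseteq> {y. (x, y) \<in> S}" using V(4,7) by auto
    ultimately show "\<exists>T. openin (complex_top Y) T \<and> y \<in> T \<and> T \<subseteq> {y. (x, y) \<in> S}" by blast
  qed
  show "openin (complex_top X) {x. (x, y) \<in> S}"
  proof (subst openin_subopen, intro ballI)
    fix x assume "x \<in> {x. (x, y) \<in> S}"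
    then have xy: "(x, y) \<in> S" by simp
    obtain V W q where V: "openin (zariski X) V" "openin (zariski Y) W" "q \<in> generated_algebra UNIV (?C V W)"
      "x \<in> V" "y \<in> W" "q (x, y) \<noteq> 0" "{p \<in> V \<times> W. q p \<noteq> 0} \<subseteq> S"
      using nbhd[OF xy] by (elim exE conjE) (rule that)
    have "c \<circ> (\<lambda>x. (x, y)) \<in> generated_algebra UNIV (reg X V)" if "c \<in> ?C V W" for c
      using that generated_algebra.const[OF UNIV_I] generated_algebra.gen by (fastforce simp: o_def)
    then have "q \<circ> (\<lambda>x. (x, y)) \<in> generated_algebra UNIV (reg X V)"
      by (rule generated_algebra_comp[OF V(3)])
    then have "openin (complex_top X) {x \<in> V. (q \<circ> (\<lambda>x. (x, y))) x \<noteq> 0}"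
      by (rule openin_complex_nonvanishing[OF V(1)])
    moreover have "x \<in> {x \<in> V. (q \<circ> (\<lambda>x. (x, y))) x \<noteq> 0}" using V(4,6) by simp
    moreover have "{x \<in> V. (q \<circ> (\<lambda>x. (x, y))) x \<noteq> 0} \<subseteq> {x. (x, y) \<in> S}" using V(5,7) by auto
    ultimately show "\<exists>T. openin (complex_top X) T \<and> x \<in> T \<and> T \<subseteq> {x. (x, y) \<in> S}" by blast
  qed
qed

section \<open>Matrix groups\<close>

lemma function_space_mat: "function_space (mat_fspace \<rat> H)"
  unfolding mat_fspace_def by (rule function_space_affine)

lemma topspace_mat: "topspace (zariski (mat_fspace \<rat> H)) = H"
  unfolding mat_fspace_def by (rule topspace_affine)

lemma entry_regular: "(\<lambda>A. A $ i $ j) \<in> reg (mat_fspace \<rat> H) H"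
proof -
  have "(\<lambda>A. A $ i $ j) \<in> generated_algebra \<rat> entries"
    by (rule generated_algebra.gen) (auto simp: entries_def)
  then show ?thesis
    unfolding mat_fspace_def affine_fspace_def
    by (rule subsetD[OF patch_subset_reg[OF directed_patches_single[OF generated_algebra_idem] singletonI]])
qed

lemma (in function_space) regular_sum:
  assumes V: "openin (zariski X) V" and "finite I" and "\<And>i. i \<in> I \<Longrightarrow> f i \<in> reg X V"
  shows "(\<lambda>x. \<Sum>i\<in>I. f i x) \<in> reg X V"
  using assms(2,3)
proof (induction I rule: finite_induct)
  case empty
  then show ?case using regular_const[OF V, of 0] by simp
next
  case (insert i I)
  then have "(\<lambda>x. f i x + (\<Sum>i\<in>I. f i x)) \<in> reg X V" by (intro regular_add[OF V]) auto
  then show ?case using insert.hyps by simp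
qed

text \<open>Every entry of a product is a sum of products of entries. The three sets are independent
  because the lemma serves both \<open>Bm\<close> times \<open>Bm\<close> into \<open>Bm\<close> and
  \<open>U\<close> times \<open>Bm\<close> into \<open>G\<close>.\<close>

lemma regular_on_matrix_mult:
  assumes KLH: "\<And>a b. a \<in> K \<Longrightarrow> b \<in> L \<Longrightarrow> a ** b \<in> H"
  shows "regular_on (mat_fspace \<rat> K \<otimes>\<^sub>v mat_fspace \<rat> L) (K \<times> L) (\<lambda>p. fst p ** snd p) (mat_fspace \<rat> H)"
  unfolding mat_fspace_def[of \<rat> H]
proof (rule regular_on_affine)
  let ?X = "mat_fspace \<rat> K \<otimes>\<^sub>v mat_fspace \<rat> L"
  interpret X: function_space ?X by (intro function_space_prod function_space_mat)
  show "function_space ?X" by (rule X.function_space_axioms)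
  have top: "topspace (zariski ?X) = K \<times> L"
    by (simp add: topspace_prod function_space_mat topspace_mat)
  show op: "openin (zariski ?X) (K \<times> L)" unfolding top[symmetric] by (rule openin_topspace)
  show "(\<lambda>p. fst p ** snd p) ` (K \<times> L) \<subseteq> H" using KLH by auto
  fix c assume "c \<in> (entries :: ('a cmat \<Rightarrow> complex) set)"
  then obtain i j where c: "c = (\<lambda>A. A $ i $ j)" by (auto simp: entries_def)
  have K: "openin (zariski (mat_fspace \<rat> K)) K" and L: "openin (zariski (mat_fspace \<rat> L)) L"
    using openin_topspace[of "zariski (mat_fspace \<rat> K)"] openin_topspace[of "zariski (mat_fspace \<rat> L)"]
    by (simp_all add: topspace_mat)
  have f: "regular_on ?X (K \<times> L) fst (mat_fspace \<rat> K)" and g: "regular_on ?X (K \<times> L) snd (mat_fspace \<rat> L)"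
    unfolding top[symmetric] by (intro regular_on_fst regular_on_snd function_space_mat)+
  have "(K \<times> L) \<inter> fst -` K = K \<times> L" "(K \<times> L) \<inter> snd -` L = K \<times> L" by auto
  then have "(\<lambda>A. A $ i $ k) \<circ> fst \<in> reg ?X (K \<times> L)" "(\<lambda>A. A $ k $ j) \<circ> snd \<in> reg ?X (K \<times> L)" for k
    using regular_on_pullback[OF f K entry_regular] regular_on_pullback[OF g L entry_regular]
    by (simp_all only:)
  then have "(\<lambda>p. \<Sum>k\<in>UNIV. ((\<lambda>A. A $ i $ k) \<circ> fst) p * ((\<lambda>A. A $ k $ j) \<circ> snd) p) \<in> reg ?X (K \<times> L)"
    by (intro X.regular_sum op X.regular_mult finite)
  then show "c \<circ> (\<lambda>p. fst p ** snd p) \<in> reg ?X (K \<times> L)"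
    by (simp add: c o_def matrix_matrix_mult_def)
qed

lemma complex_top_mat_basis:
  assumes "openin (complex_top (mat_fspace \<rat> H)) S" "A \<in> S"
  obtains q where "q \<in> generated_algebra UNIV entries" "A \<in> H" "q A \<noteq> 0" "{B \<in> H. q B \<noteq> 0} \<subseteq> S"
proof -
  obtain V C q where V: "(V, C) \<in> {(H, generated_algebra \<rat> entries)}" "q \<in> generated_algebra UNIV C"
    "A \<in> V" "q A \<noteq> 0" "{B \<in> V. q B \<noteq> 0} \<subseteq> S"
    by (rule patches_complex_basis[OF directed_patches_single[OF generated_algebra_idem]
        assms(1)[unfolded mat_fspace_def affine_fspace_def] assms(2)]) (rule that)
  from V(1) have VC: "V = H" "C = generated_algebra \<rat> entries" by simp_all
  have "C \<subseteq> generated_algebra UNIV entries" unfolding VC by (rule generated_algebra_mono) simp_all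
  then have "q \<in> generated_algebra UNIV (generated_algebra UNIV entries)"
    by (rule subsetD[OF generated_algebra_mono[OF subset_refl] V(2)])
  then have "q \<in> generated_algebra UNIV entries" by (rule subsetD[OF generated_algebra_idem])
  then show ?thesis using V(3-5) unfolding VC by (rule that)
qed

lemma openin_complex_mat_nonvanishing:
  assumes "q \<in> generated_algebra UNIV entries"
  shows "openin (complex_top (mat_fspace \<rat> H)) {B \<in> H. q B \<noteq> 0}"
proof (rule openin_complex_nonvanishing)
  show "openin (zariski (mat_fspace \<rat> H)) H"
    using openin_topspace[of "zariski (mat_fspace \<rat> H)"] by (simp add: topspace_mat)
  have "entries \<subseteq> reg (mat_fspace \<rat> H) H" using entry_regular by (auto simp: entries_def)
  then show "q \<in> generated_algebra UNIV (reg (mat_fspace \<rat> H) H)"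
    by (rule subsetD[OF generated_algebra_mono[OF subset_refl] assms])
qed

text \<open>As \<open>b\<close> has complex entries, translation by it need not be a morphism over
  the rationals, so continuity is claimed for \<open>complex_top\<close>. It holds because a
  polynomial in the entries of \<open>u ** b\<close> is a complex polynomial in those of
  \<open>u\<close>.\<close>

lemma openin_complex_right_translation:
  assumes "openin (complex_top (mat_fspace \<rat> G)) S" and UG: "\<And>u. u \<in> U \<Longrightarrow> u ** b \<in> G"
  shows "openin (complex_top (mat_fspace \<rat> U)) {u \<in> U. u ** b \<in> S}"
proof (subst openin_subopen, intro ballI)
  fix u assume "u \<in> {u \<in> U. u ** b \<in> S}"
  then have u: "u \<in> U" "u ** b \<in> S" by auto
  obtain q where q: "q \<in> generated_algebra UNIV entries" "q (u ** b) \<noteq> 0" "{B \<in> G. q B \<noteq> 0} \<subseteq> S"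
    by (rule complex_top_mat_basis[OF assms(1) u(2)]) (rule that)
  have "q \<circ> (\<lambda>u. u ** b) \<in> generated_algebra UNIV entries"
    using q(1)
  proof (rule generated_algebra_comp)
    fix c assume "c \<in> (entries :: ('a cmat \<Rightarrow> complex) set)"
    then obtain i j where c: "c = (\<lambda>A. A $ i $ j)" by (auto simp: entries_def)
    have "(\<lambda>u. \<Sum>k\<in>K. u $ i $ k * b $ k $ j) \<in> generated_algebra UNIV entries" if "finite K" for K
      using that
    proof (induction K rule: finite_induct)
      case (insert k K)
      have "(\<lambda>u. u $ i $ k) \<in> generated_algebra UNIV entries"
        by (rule generated_algebra.gen) (auto simp: entries_def)
      then have "(\<lambda>u. u $ i $ k * b $ k $ j + (\<Sum>k\<in>K. u $ i $ k * b $ k $ j))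
          \<in> generated_algebra UNIV entries"
        by (intro generated_algebra.add generated_algebra.mult generated_algebra.const UNIV_I insert.IH)
      then show ?case using insert.hyps by simp
    qed (simp add: generated_algebra.const)
    from this[OF finite_class.finite_UNIV]
    show "c \<circ> (\<lambda>u. u ** b) \<in> generated_algebra UNIV entries"
      by (simp add: c o_def matrix_matrix_mult_def)
  qed
  then have "openin (complex_top (mat_fspace \<rat> U)) {v \<in> U. (q \<circ> (\<lambda>u. u ** b)) v \<noteq> 0}"
    by (rule openin_complex_mat_nonvanishing)
  moreover have "u \<in> {v \<in> U. (q \<circ> (\<lambda>u. u ** b)) v \<noteq> 0}" using u(1) q(2) by simp
  moreover have "{v \<in> U. (q \<circ> (\<lambda>u. u ** b)) v \<noteq> 0} \<subseteq> {u \<in> U. u ** b \<in> S}" using q(3) UG by auto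
  ultimately show "\<exists>T. openin (complex_top (mat_fspace \<rat> U)) T \<and> u \<in> T \<and> T \<subseteq> {u \<in> U. u ** b \<in> S}"
    by blast
qed

section \<open>Linear groups, unipotent matrices and irreducibility\<close>

lemma group_GL: "Group.group (GL :: 'n::finite cmat monoid)"
proof (rule groupI)
  show "x \<otimes>\<^bsub>GL\<^esub> y \<in> carrier GL" if "x \<in> carrier GL" "y \<in> carrier GL" for x y :: "'n cmat"
    using that by (simp add: GL_def invertible_mult)
  show "\<one>\<^bsub>GL\<^esub> \<in> carrier (GL :: 'n cmat monoid)"
    by (auto simp: GL_def invertible_def intro: exI[of _ "mat 1"])
  show "\<exists>y\<in>carrier GL. y \<otimes>\<^bsub>GL\<^esub> x = \<one>\<^bsub>GL\<^esub>" if "x \<in> carrier GL" for x :: "'n cmat"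
    using that unfolding GL_def by (auto simp: invertible_def)
qed (simp_all add: GL_def matrix_mul_assoc)

lemma
  assumes "subgroup H GL"
  shows GL_subgroup_one: "mat 1 \<in> H"
    and GL_subgroup_mult: "a \<in> H \<Longrightarrow> b \<in> H \<Longrightarrow> a ** b \<in> H"
    and GL_subgroup_inverse: "a \<in> H \<Longrightarrow> \<exists>b\<in>H. b ** a = mat 1 \<and> a ** b = mat 1"
proof -
  interpret H: subgroup H GL by fact
  interpret GL: group GL by (rule group_GL)
  show "mat 1 \<in> H" using H.one_closed by (simp add: GL_def)
  show "a ** b \<in> H" if "a \<in> H" "b \<in> H" using H.m_closed[OF that] by (simp add: GL_def)
  show "\<exists>b\<in>H. b ** a = mat 1 \<and> a ** b = mat 1" if "a \<in> H"
    using GL.l_inv[OF H.mem_carrier[OF that]] GL.r_inv[OF H.mem_carrier[OF that]] H.m_inv_closed[OF that]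
    by (intro bexI[of _ "inv\<^bsub>GL\<^esub> a"]) (simp_all add: GL_def)
qed

lemma matrix_add_rdistrib: "(A + B) ** C = A ** C + B ** (C :: 'a::semiring_1 ^ _ ^ _)"
  by (vector matrix_matrix_mult_def sum.distrib distrib_right)

lemma matrix_diff_rdistrib: "(A - B) ** C = A ** C - B ** (C :: 'a::ring_1 ^ _ ^ _)"
  by (vector matrix_matrix_mult_def sum_subtractf left_diff_distrib)

lemma matrix_diff_ldistrib: "A ** (B - C) = A ** B - A ** (C :: 'a::ring_1 ^ _ ^ _)"
  by (vector matrix_matrix_mult_def sum_subtractf right_diff_distrib)

lemma matrix_funpow_add:
  fixes A B C :: "'n::finite cmat"
  shows "((**) A ^^ n) (B + C) = ((**) A ^^ n) B + ((**) A ^^ n) C"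
  by (induction n) (simp_all add: matrix_add_ldistrib)

lemma matrix_funpow_mult:
  fixes A B C :: "'n::finite cmat"
  shows "((**) A ^^ n) (B ** C) = ((**) A ^^ n) B ** C"
  by (induction n) (simp_all add: matrix_mul_assoc)

text \<open>The binomial theorem for the powers of 1 + N. The range \<open>k < m\<close> is
  independent of \<open>n\<close>: coefficients vanish for k above \<open>n\<close>, and
  \<open>N\<close> kills \<open>B\<close> from the m-th power on. The induction runs through
  \<open>B\<close> and \<open>N ** B\<close>.\<close>

lemma unipotent_funpow_binomial:
  fixes N B :: "'n::finite cmat"
  assumes "((**) N ^^ m) B = 0"
  shows "((**) (mat 1 + N) ^^ n) B $ i $ j =
    (\<Sum>k<m. of_nat (n choose k) * ((**) N ^^ k) B $ i $ j)"
  using assms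
proof (induction n arbitrary: B)
  case 0
  \<comment> \<open>For \<open>m = 0\<close> the hypothesis says that \<open>B\<close> is zero,
    which matches the empty sum.\<close>
  then show ?case by (cases m) (simp_all add: sum.lessThan_Suc_shift del: sum.lessThan_Suc)
next
  case (Suc n)
  define a where "a k = ((**) N ^^ k) B $ i $ j" for k
  have a_Suc: "((**) N ^^ k) (N ** B) $ i $ j = a (Suc k)" for k
    by (simp add: a_def funpow_swap1)
  have am: "a m = 0" by (simp add: a_def Suc.prems)
  have Nm: "((**) N ^^ m) (N ** B) = 0" using Suc.prems by (simp add: funpow_swap1[symmetric])
  have "((**) (mat 1 + N) ^^ Suc n) B = ((**) (mat 1 + N) ^^ n) (B + N ** B)"
    by (simp add: funpow_Suc_right matrix_add_rdistrib del: funpow.simps)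
  then have "((**) (mat 1 + N) ^^ Suc n) B $ i $ j =
      (\<Sum>k<m. of_nat (n choose k) * a k) + (\<Sum>k<m. of_nat (n choose k) * a (Suc k))"
    using Suc.IH[OF Suc.prems] Suc.IH[OF Nm] by (simp only: matrix_funpow_add vector_add_component a_Suc a_def)
  also have "\<dots> = (\<Sum>k<m. of_nat (Suc n choose k) * a k)"
  proof (cases m)
    case (Suc l)
    \<comment> \<open>The top term of the shifted sum contains \<open>a m\<close> and vanishes; the
      remaining terms combine by the rule of Pascal.\<close>
    have "a (Suc l) = 0" using am Suc by simp
    then show ?thesis
      unfolding Suc by (subst (1 3) sum.lessThan_Suc_shift) (simp add: sum.distrib[symmetric] algebra_simps)
  qed simp
  finally show ?case by (simp add: a_def)
qed

text \<open>The polynomial is the falling factorial X (X - 1) ... (X - k + 1) divided by k!, which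
  also has the right value 0 at every n below k.\<close>

lemma binomial_is_polynomial:
  "\<exists>p::complex poly. \<forall>n. poly p (of_nat n) = of_nat (n choose k)"
proof (intro exI allI)
  fix n
  show "poly (smult (1 / fact k) (\<Prod>i=0..<k. [:- of_nat i, 1:])) (of_nat n :: complex) = of_nat (n choose k)"
    by (simp add: poly_prod gbinomial_prod_rev binomial_gbinomial)
qed

text \<open>The entries of the n-th power of \<open>u\<close> times \<open>b\<close> are
  combinations of finitely many binomial coefficients of n, the number being bounded by the
  nilpotency order of u - 1. Polynomials in the entries inherit this.\<close>

lemma unipotent_orbit_polynomial:
  fixes u b :: "'n::finite cmat"
  assumes u: "unipotent u" and "q \<in> generated_algebra UNIV entries"
  shows "\<exists>p. \<forall>n. q (((**) u ^^ n) b) = poly p (of_nat n)"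
  using assms(2)
proof induction
  case (const c)
  show ?case by (intro exI[of _ "[:c:]"]) simp
next
  case (gen f)
  then obtain i j where f: "f = (\<lambda>A. A $ i $ j)" by (auto simp: entries_def)
  obtain m where "((**) (u - mat 1) ^^ m) (mat 1) = 0" using u by (auto simp: unipotent_def)
  then have "((**) (u - mat 1) ^^ m) b = 0"
    using matrix_funpow_mult[of m "u - mat 1" "mat 1" b] by simp
  from unipotent_funpow_binomial[OF this]
  have *: "((**) u ^^ n) b $ i $ j =
      (\<Sum>k<m. of_nat (n choose k) * ((**) (u - mat 1) ^^ k) b $ i $ j)" for n
    by simp
  obtain p :: "nat \<Rightarrow> complex poly" where p: "\<And>k n. poly (p k) (of_nat n) = of_nat (n choose k)"
    using binomial_is_polynomial by metis
  show ?case
    by (intro exI[of _ "\<Sum>k<m. smult (((**) (u - mat 1) ^^ k) b $ i $ j) (p k)"])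
      (simp add: f * poly_sum p mult.commute)
next
  case (add f g)
  then obtain p r where "\<forall>n. f (((**) u ^^ n) b) = poly p (of_nat n)" "\<forall>n. g (((**) u ^^ n) b) = poly r (of_nat n)"
    by blast
  then show ?case by (intro exI[of _ "p + r"]) simp
next
  case (mult f g)
  then obtain p r where "\<forall>n. f (((**) u ^^ n) b) = poly p (of_nat n)" "\<forall>n. g (((**) u ^^ n) b) = poly r (of_nat n)"
    by blast
  then show ?case by (intro exI[of _ "p * r"]) simp
qed

text \<open>Any two points \<open>a, b\<close> lie on the orbit \<open>n \<mapsto> (b a\<^sup>-\<^sup>1)\<^sup>n a\<close>, which is polynomial in \<open>n\<close>.\<close>

lemma unipotent_group_irreducible:
  assumes H: "subgroup H GL" "\<And>u. u \<in> H \<Longrightarrow> unipotent u"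
    and S: "openin (complex_top (mat_fspace \<rat> H)) S" "S \<noteq> {}"
    and R: "openin (complex_top (mat_fspace \<rat> H)) R" "R \<noteq> {}"
  shows "S \<inter> R \<noteq> {}"
proof -
  obtain a b where ab: "a \<in> S" "b \<in> R" using S(2) R(2) by blast
  obtain q where q: "q \<in> generated_algebra UNIV entries" "a \<in> H" "q a \<noteq> 0" "{B \<in> H. q B \<noteq> 0} \<subseteq> S"
    by (rule complex_top_mat_basis[OF S(1) ab(1)]) (rule that)
  obtain r where r: "r \<in> generated_algebra UNIV entries" "b \<in> H" "r b \<noteq> 0" "{B \<in> H. r B \<noteq> 0} \<subseteq> R"
    by (rule complex_top_mat_basis[OF R(1) ab(2)]) (rule that)
  obtain a' where a': "a' \<in> H" "a' ** a = mat 1" using GL_subgroup_inverse[OF H(1) q(2)] by blast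
  define u where "u = b ** a'"
  have u: "u \<in> H" unfolding u_def by (rule GL_subgroup_mult[OF H(1) r(2) a'(1)])
  have ua: "u ** a = b" by (simp add: u_def a'(2) matrix_mul_assoc[symmetric])
  have mem: "((**) u ^^ n) a \<in> H" for n
    by (induction n) (simp_all add: q(2) GL_subgroup_mult[OF H(1) u])
  obtain p where p: "\<And>n. q (((**) u ^^ n) a) = poly p (of_nat n)"
    using unipotent_orbit_polynomial[OF H(2)[OF u] q(1)] by blast
  obtain p' where p': "\<And>n. r (((**) u ^^ n) a) = poly p' (of_nat n)"
    using unipotent_orbit_polynomial[OF H(2)[OF u] r(1)] by blast
  \<comment> \<open>The orbit passes through \<open>a\<close> at n = 0 and through \<open>b\<close>
    at n = 1, so neither polynomial is zero. Their product has finitely many roots and some natural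
    number avoids them all.\<close>
  have "p \<noteq> 0" using p[of 0] q(3) by auto
  moreover have "p' \<noteq> 0" using p'[of 1] r(3) ua by auto
  ultimately have "finite {z. poly (p * p') z = 0}" by (intro poly_roots_finite) simp
  then have "\<not> range (of_nat :: nat \<Rightarrow> complex) \<subseteq> {z. poly (p * p') z = 0}"
    using range_inj_infinite[OF inj_of_nat] finite_subset by blast
  then obtain n where "poly p (of_nat n) \<noteq> 0" "poly p' (of_nat n) \<noteq> 0" by auto
  then have "q (((**) u ^^ n) a) \<noteq> 0" "r (((**) u ^^ n) a) \<noteq> 0" by (simp_all add: p p')
  then have "((**) u ^^ n) a \<in> S \<inter> R" using q(4) r(4) mem[of n] by blast
  then show ?thesis by blast
qed

section \<open>Unipotent elements of tori\<close>

lemma matrix_mult_diagonal: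
  fixes D M :: "'n::finite cmat"
  assumes "\<And>i j. i \<noteq> j \<Longrightarrow> D $ i $ j = 0"
  shows "(D ** M) $ i $ j = D $ i $ i * M $ i $ j"
proof -
  have "(\<Sum>k\<in>UNIV. D $ i $ k * M $ k $ j) = (\<Sum>k\<in>UNIV. if k = i then D $ i $ i * M $ i $ j else 0)"
    using assms[of i] by (intro sum.cong) auto
  then show ?thesis by (simp add: matrix_matrix_mult_def)
qed

text \<open>A nilpotent diagonal matrix is zero. This is applied to the conjugate of A - 1 by the
  matrix \<open>P\<close> that diagonalises the torus.\<close>

lemma torus_unipotent_trivial:
  fixes A :: "'n::finite cmat"
  assumes "torus k T" "A \<in> T" "unipotent A"
  shows "A = mat 1"
proof -
  obtain P :: "'n cmat" where P: "invertible P" and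
    diag: "\<And>i j. i \<noteq> j \<Longrightarrow> (matrix_inv P ** A ** P) $ i $ j = 0"
    using assms(1,2) unfolding torus_def by (elim conjE exE) (rule that, assumption, simp)
  have PP: "matrix_inv P ** P = mat 1" "P ** matrix_inv P = mat 1"
    using someI_ex[OF P[unfolded invertible_def]] unfolding matrix_inv_def by simp_all
  define N where "N = A - mat 1"
  define D where "D = matrix_inv P ** N ** P"
  have D: "D $ i $ j = 0" if "i \<noteq> j" for i j
  proof -
    have "D = matrix_inv P ** A ** P - mat 1"
      by (simp add: D_def N_def matrix_diff_ldistrib matrix_diff_rdistrib PP)
    then show ?thesis using diag[OF that] that by (simp add: mat_def)
  qed
  obtain m where m: "((**) N ^^ m) (mat 1) = 0" using assms(3) by (auto simp: unipotent_def N_def)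
  have "((**) D ^^ n) (mat 1) = matrix_inv P ** ((**) N ^^ n) (mat 1) ** P" for n
  proof (induction n)
    case (Suc n)
    have "D ** (matrix_inv P ** X ** P) = matrix_inv P ** (N ** X) ** P" for X
    proof -
      have "D ** (matrix_inv P ** X ** P) = matrix_inv P ** N ** (P ** matrix_inv P) ** X ** P"
        unfolding D_def by (simp add: matrix_mul_assoc)
      then show ?thesis by (simp add: PP matrix_mul_assoc)
    qed
    then show ?case using Suc by simp
  qed (simp add: PP)
  then have Dm: "((**) D ^^ m) (mat 1) = 0" by (simp add: m)
  have "((**) D ^^ n) (mat 1) $ i $ i = (D $ i $ i) ^ n" for i n
    by (induction n) (simp_all add: mat_def matrix_mult_diagonal[OF D])
  from this[of m] have "(D $ i $ i) ^ m = 0" for i by (simp add: Dm)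
  then have "D $ i $ i = 0" for i by (metis power_not_zero)
  with D have "D = 0" by (metis vec_eq_iff zero_index)
  have "N = (P ** matrix_inv P) ** N ** (P ** matrix_inv P)" by (simp add: PP)
  also have "\<dots> = P ** D ** matrix_inv P" unfolding D_def by (simp add: matrix_mul_assoc)
  finally show ?thesis using \<open>D = 0\<close> by (simp add: N_def)
qed

section \<open>Products of crystals\<close>

lemma rational_map_iff:
  "rational_map X Y f \<longleftrightarrow> regular_partial X Y f \<and>
     (\<forall>S. openin (complex_top X) S \<and> S \<noteq> {} \<longrightarrow> dom f \<inter> S \<noteq> {})"
  unfolding rational_map_def regular_partial_def closure_of_complex_top_iff by blast

lemma rational_map_meets:
  assumes "rational_map X Y f" "openin (complex_top X) S" "x \<in> S"
  obtains x' y where "x' \<in> S" "f x' = Some y"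
proof -
  have "dom f \<inter> S \<noteq> {}" using assms unfolding rational_map_iff by blast
  then show ?thesis using that by auto
qed

lemma rat_eq_refl:
  assumes "rational_map X Y f"
  shows "rat_eq X Y f f"
  unfolding rat_eq_def using assms
  by (intro conjI exI[of _ "dom f"]) (simp_all add: rational_map_def regular_on_def)

text \<open>What the later arguments take from the structure of \<open>G\<close>. The trivial
  intersection makes the factorization of an element unique, and unipotence of \<open>U\<close>
  provides irreducibility.\<close>

locale unipotent_factorization =
  fixes G Bm U :: "'n::finite cmat set" and piBm piU :: "'n cmat \<rightharpoonup> 'n cmat"
  assumes factorization: "factorization G Bm U piBm piU"
    and G_subgroup: "subgroup G GL" and Bm_subgroup: "subgroup Bm GL" and U_subgroup: "subgroup U GL"
    and U_unipotent: "\<And>u. u \<in> U \<Longrightarrow> unipotent u"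
    and Bm_Int_U: "Bm \<inter> U \<subseteq> {mat 1}"
begin

lemma piU_partial: "regular_partial (mat_fspace \<rat> G) (mat_fspace \<rat> U) piU"
  using factorization unfolding factorization_def rational_map_iff by blast

text \<open>\<open>dom piU\<close> is open in the space of \<open>G\<close>, hence contained in
  \<open>G\<close>. Setting one factor to 1 then places \<open>Bm\<close> and \<open>U\<close>
  inside \<open>G\<close>.\<close>

lemma product_in_G: "b \<in> Bm \<Longrightarrow> u \<in> U \<Longrightarrow> b ** u \<in> G"
proof -
  assume "b \<in> Bm" "u \<in> U"
  then have "b ** u \<in> dom piU" using factorization unfolding factorization_def by blast
  then show ?thesis using openin_subset[OF regular_partial_dom[OF piU_partial]] by (auto simp: topspace_mat)
qed

lemma Bm_subset_G: "b \<in> Bm \<Longrightarrow> b \<in> G"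
  using product_in_G[OF _ GL_subgroup_one[OF U_subgroup]] by simp

lemma U_subset_G: "u \<in> U \<Longrightarrow> u \<in> G"
  using product_in_G[OF GL_subgroup_one[OF Bm_subgroup]] by simp

text \<open>\<open>factorization\<close> asserts only that the two values multiply to g. Uniqueness
  comes from b u = c v: the element with the two expressions (inverse of c) times b and v times
  (inverse of u) lies in both \<open>Bm\<close> and \<open>U\<close>, hence is 1. From here on
  \<open>piU\<close> is handled purely algebraically.\<close>

lemma piU_eq_Some_iff: "piU g = Some u \<longleftrightarrow> u \<in> U \<and> (\<exists>b\<in>Bm. g = b ** u)"
proof -
  have decomposition: "\<exists>b\<in>Bm. g = b ** v" if "piU g = Some v" for v
  proof -
    have g: "g \<in> dom piU" using that by blast
    then have "g \<in> dom piBm" using factorization unfolding factorization_def by simp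
    then obtain b where b: "piBm g = Some b" by blast
    have "regular_partial (mat_fspace \<rat> G) (mat_fspace \<rat> Bm) piBm"
      using factorization unfolding factorization_def rational_map_iff by blast
    from regular_partial_range_topspace[OF this b] have "b \<in> Bm" by (simp add: topspace_mat)
    moreover have "g = the (piBm g) ** the (piU g)"
      using factorization g unfolding factorization_def by blast
    ultimately show ?thesis using b that by auto
  qed
  have range: "v \<in> U" if "piU g = Some v" for v
    using regular_partial_range_topspace[OF piU_partial that] by (simp add: topspace_mat)
  show ?thesis
  proof
    assume "piU g = Some u"
    then show "u \<in> U \<and> (\<exists>b\<in>Bm. g = b ** u)" using decomposition range by blast
  next
    assume "u \<in> U \<and> (\<exists>b\<in>Bm. g = b ** u)"
    then obtain b where b: "u \<in> U" "b \<in> Bm" "g = b ** u" by blast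
    then have "g \<in> dom piU" using factorization unfolding factorization_def by blast
    then obtain v where v: "piU g = Some v" by blast
    then obtain c where c: "c \<in> Bm" "g = c ** v" using decomposition by blast
    obtain c' where c': "c' \<in> Bm" "c' ** c = mat 1"
      using GL_subgroup_inverse[OF Bm_subgroup c(1)] by blast
    obtain u' where u': "u' \<in> U" "u ** u' = mat 1" "u' ** u = mat 1"
      using GL_subgroup_inverse[OF U_subgroup b(1)] by blast
    have eq: "b ** u = c ** v" using b(3) c(2) by simp
    have "c' ** b = c' ** (b ** u) ** u'" by (simp add: matrix_mul_assoc[symmetric] u'(2))
    also have "\<dots> = (c' ** c) ** v ** u'" by (simp add: eq matrix_mul_assoc)
    also have "\<dots> = v ** u'" by (simp add: c'(2))
    finally have *: "c' ** b = v ** u'" .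
    have "c' ** b \<in> Bm" by (rule GL_subgroup_mult[OF Bm_subgroup c'(1) b(2)])
    moreover have "v ** u' \<in> U" by (rule GL_subgroup_mult[OF U_subgroup range[OF v] u'(1)])
    ultimately have "v ** u' = mat 1" using * Bm_Int_U by auto
    then have "v ** u' ** u = u" by simp
    then have "v = u" by (simp add: matrix_mul_assoc[symmetric] u'(3))
    then show "piU g = Some u" using v by simp
  qed
qed

text \<open>The set of products of \<open>Bm\<close> with \<open>U\<close> is stable under left
  multiplication by \<open>Bm\<close>, so the equation also covers the case where both sides are
  undefined. This is what later permits equality of partial functions.\<close>

lemma piU_Bm_mult:
  assumes "b \<in> Bm"
  shows "piU (b ** g) = piU g"
proof -
  obtain b' where b': "b' \<in> Bm" "b' ** b = mat 1"
    using GL_subgroup_inverse[OF Bm_subgroup assms] by blast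
  have "piU (b ** g) = Some u \<longleftrightarrow> piU g = Some u" for u
  proof
    assume "piU (b ** g) = Some u"
    then obtain c where c: "u \<in> U" "c \<in> Bm" "b ** g = c ** u" by (auto simp: piU_eq_Some_iff)
    have "g = (b' ** b) ** g" by (simp add: b'(2))
    also have "\<dots> = (b' ** c) ** u" by (simp only: matrix_mul_assoc[symmetric] c(3))
    finally show "piU g = Some u"
      unfolding piU_eq_Some_iff using c(1) GL_subgroup_mult[OF Bm_subgroup b'(1) c(2)] by blast
  next
    assume "piU g = Some u"
    then obtain c where c: "u \<in> U" "c \<in> Bm" "g = c ** u" by (auto simp: piU_eq_Some_iff)
    have "b ** g = (b ** c) ** u" by (simp only: c(3) matrix_mul_assoc)
    then show "piU (b ** g) = Some u"
      unfolding piU_eq_Some_iff using c(1) GL_subgroup_mult[OF Bm_subgroup assms c(2)] by blast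
  qed
  then show ?thesis by (metis option.exhaust)
qed

text \<open>The identity behind associativity: g = b v gives g c = b (v c), and the factor b in
  \<open>Bm\<close> is invisible to \<open>piU\<close>.\<close>

lemma piU_mult_cong:
  assumes "piU g = Some v"
  shows "piU (g ** c) = piU (v ** c)"
proof -
  obtain b where "b \<in> Bm" "g = b ** v" using assms by (auto simp: piU_eq_Some_iff)
  then show ?thesis using piU_Bm_mult[of b "v ** c"] by (simp add: matrix_mul_assoc)
qed

text \<open>The map \<open>u \<mapsto> \<pi>(u b)\<close> is birational, with inverse \<open>v \<mapsto> \<pi>(v b\<^sup>-\<^sup>1)\<close>, hence dominant.\<close>

lemma piU_translate_preimage:
  assumes b: "b \<in> Bm" and D: "openin (complex_top (mat_fspace \<rat> U)) D" "D \<noteq> {}"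
  shows "openin (complex_top (mat_fspace \<rat> U)) {u \<in> U. \<exists>v\<in>D. piU (u ** b) = Some v}"
    and "{u \<in> U. \<exists>v\<in>D. piU (u ** b) = Some v} \<noteq> {}"
proof -
  have UG: "u ** c \<in> G" if "u \<in> U" "c \<in> Bm" for u c
    using GL_subgroup_mult[OF G_subgroup U_subset_G[OF that(1)] Bm_subset_G[OF that(2)]] .
  \<comment> \<open>Stated for every \<open>c\<close> in \<open>Bm\<close>, since it is applied both
    to \<open>b\<close> and to its inverse.\<close>
  have preimage: "openin (complex_top (mat_fspace \<rat> U)) {u \<in> U. \<exists>v\<in>S. piU (u ** c) = Some v}"
    if c: "c \<in> Bm" and S: "openin (complex_top (mat_fspace \<rat> U)) S" for c S
    using openin_complex_right_translation[OF
        regular_partial_complex_openin[OF function_space_mat piU_partial S] UG[OF _ c]]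
    by simp
  show "openin (complex_top (mat_fspace \<rat> U)) {u \<in> U. \<exists>v\<in>D. piU (u ** b) = Some v}"
    by (rule preimage[OF b D(1)])
  obtain b' where b': "b' \<in> Bm" "b' ** b = mat 1" "b ** b' = mat 1"
    using GL_subgroup_inverse[OF Bm_subgroup b] by blast
  have "openin (complex_top (mat_fspace \<rat> U)) U"
    using openin_topspace[of "complex_top (mat_fspace \<rat> U)"]
    by (simp add: topspace_complex_top topspace_mat)
  from preimage[OF b'(1) this]
  have "openin (complex_top (mat_fspace \<rat> U)) {v \<in> U. \<exists>u\<in>U. piU (v ** b') = Some u}" .
  \<comment> \<open>The inverse map is defined at 1, because \<open>b'\<close> factors as
    \<open>b'\<close> times 1.\<close>
  moreover have "mat 1 \<in> {v \<in> U. \<exists>u\<in>U. piU (v ** b') = Some u}"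
  proof -
    have "piU (mat 1 ** b') = Some (mat 1)"
      unfolding piU_eq_Some_iff using GL_subgroup_one[OF U_subgroup] b'(1) by auto
    then show ?thesis using GL_subgroup_one[OF U_subgroup] by blast
  qed
  \<comment> \<open>Irreducibility yields a point \<open>v\<close> of \<open>D\<close> at which the
    inverse map is defined; its image \<open>u\<close> is the preimage of \<open>v\<close>
    sought.\<close>
  ultimately have "D \<inter> {v \<in> U. \<exists>u\<in>U. piU (v ** b') = Some u} \<noteq> {}"
    using unipotent_group_irreducible[OF U_subgroup U_unipotent D] by blast
  then obtain v u where v: "v \<in> D" "v \<in> U" "u \<in> U" "piU (v ** b') = Some u" by blast
  then obtain c where c: "c \<in> Bm" "v ** b' = c ** u" by (auto simp: piU_eq_Some_iff)
  have "v = (v ** b') ** b" by (simp add: matrix_mul_assoc[symmetric] b'(2))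
  also have "\<dots> = c ** (u ** b)" by (simp only: c(2) matrix_mul_assoc)
  finally have "piU (u ** b) = piU v" using piU_Bm_mult[OF c(1), of "u ** b"] by simp
  also have "\<dots> = Some v"
    unfolding piU_eq_Some_iff using v(2) GL_subgroup_one[OF Bm_subgroup] by (auto intro!: bexI[of _ "mat 1"])
  finally show "{u \<in> U. \<exists>v\<in>D. piU (u ** b) = Some v} \<noteq> {}" using v(1,3) by blast
qed

text \<open>Here \<open>s\<close> constrains only x and \<open>t\<close> only y, so density needs no
  more than moving one coordinate after the other.\<close>

lemma rational_map_str_prod:
  fixes X :: "'x fspace" and Y :: "'y fspace"
  assumes fs: "function_space X" "function_space Y"
    and s: "rational_map X (mat_fspace \<rat> Bm) s" and t: "rational_map Y (mat_fspace \<rat> Bm) t"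
  shows "rational_map (X \<otimes>\<^sub>v Y) (mat_fspace \<rat> Bm) (\<lambda>(x, y). do { b \<leftarrow> s x; c \<leftarrow> t y; Some (b ** c) })"
    (is "rational_map ?X ?B ?f")
  unfolding rational_map_iff
proof (intro conjI allI impI)
  let ?T = "topspace (zariski ?X)"
  have sp: "regular_partial X ?B s" and tp: "regular_partial Y ?B t"
    using s t by (simp_all add: rational_map_iff)
  interpret XY: function_space ?X by (intro function_space_prod fs)
  note fsp = fs XY.function_space_axioms function_space_mat function_space_prod
  let ?fst = "\<lambda>p. if p \<in> ?T then Some (fst p) else None"
  let ?snd = "\<lambda>p. if p \<in> ?T then Some (snd p) else None"
  let ?mult = "\<lambda>p. if p \<in> Bm \<times> Bm then Some (fst p ** snd p) else None"
  let ?g = "\<lambda>p. do { q \<leftarrow> do { b \<leftarrow> Option.bind (?fst p) s; c \<leftarrow> Option.bind (?snd p) t; Some (b, c) }; ?mult q }"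
  have "regular_partial ?X ?B ?g"
    by (rule regular_partial_bind[OF fsp(3) regular_partial_pair[OF fsp(3,4,4)
          regular_partial_bind[OF fsp(3) regular_partial_Some[OF fsp(3) regular_on_fst[OF fs]] sp]
          regular_partial_bind[OF fsp(3) regular_partial_Some[OF fsp(3) regular_on_snd[OF fs]] tp]]
          regular_partial_Some[OF function_space_prod[OF fsp(4,4)] regular_on_matrix_mult[OF GL_subgroup_mult[OF Bm_subgroup]]]])
  \<comment> \<open>The guards in \<open>?g\<close> cut nothing off: if \<open>s x\<close> and
    \<open>t y\<close> are defined, then (x, y) lies in the product space and both values lie in
    \<open>Bm\<close>.\<close>
  moreover have "?g = ?f"
  proof
    fix p :: "'x \<times> 'y"
    obtain x y where p: "p = (x, y)" by (cases p)
    show "?g p = ?f p"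
    proof (cases "s x")
      case (Some b)
      note b = Some
      show ?thesis
      proof (cases "t y")
        case (Some c)
        have "p \<in> ?T"
          using regular_partial_dom_topspace[OF sp b] regular_partial_dom_topspace[OF tp Some]
          by (simp add: p topspace_prod[OF fs])
        moreover have "b \<in> Bm" "c \<in> Bm"
          using regular_partial_range_topspace[OF sp b] regular_partial_range_topspace[OF tp Some]
          by (simp_all add: topspace_mat)
        ultimately show ?thesis using b Some by (simp add: p)
      qed (simp add: p b)
    qed (simp add: p)
  qed
  ultimately show "regular_partial ?X ?B ?f" by simp
next
  fix S assume "openin (complex_top ?X) S \<and> S \<noteq> {}"
  then obtain x0 y0 where S: "openin (complex_top ?X) S" and xy: "(x0, y0) \<in> S" by auto
  obtain x b where x: "x \<in> {x. (x, y0) \<in> S}" "s x = Some b"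
    by (rule rational_map_meets[OF s openin_complex_slice_right[OF fs S], of x0 y0]) (use xy that in auto)
  \<comment> \<open>The slice is taken at the new point \<open>x\<close>, so membership in
    \<open>S\<close> is kept while y moves.\<close>
  obtain y c where y: "y \<in> {y. (x, y) \<in> S}" "t y = Some c"
    by (rule rational_map_meets[OF t openin_complex_slice_left[OF fs S], of y0 x]) (use x(1) that in auto)
  have "(x, y) \<in> dom ?f \<inter> S" using x y by auto
  then show "dom ?f \<inter> S \<noteq> {}" by blast
qed

text \<open>
  Density of the domain: a point of the given open set with \<open>(u, x)\<close> in the domain of \<open>\<alpha>\<close> and \<open>x\<close>
  in that of \<open>s\<close> is moved first in \<open>y\<close>, so that \<open>\<beta>\<close> is defined at \<open>(v, y)\<close> for some \<open>v\<close>, and then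
  in \<open>u\<close>, so that it is defined at \<open>(\<pi>(u s(x)), y)\<close>.
\<close>

lemma rational_map_act_prod:
  fixes X :: "'x fspace" and Y :: "'y fspace"
  assumes fs: "function_space X" "function_space Y"
    and \<alpha>: "rational_map (mat_fspace \<rat> U \<otimes>\<^sub>v X) X \<alpha>"
    and \<beta>: "rational_map (mat_fspace \<rat> U \<otimes>\<^sub>v Y) Y \<beta>"
    and s: "rational_map X (mat_fspace \<rat> Bm) s"
  shows "rational_map (mat_fspace \<rat> U \<otimes>\<^sub>v X \<otimes>\<^sub>v Y) (X \<otimes>\<^sub>v Y)
    (\<lambda>(u, x, y). do { x' \<leftarrow> \<alpha> (u, x); b \<leftarrow> s x; v \<leftarrow> piU (u ** b); y' \<leftarrow> \<beta> (v, y); Some (x', y') })"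
    (is "rational_map ?E _ ?f")
  unfolding rational_map_iff
proof (intro conjI allI impI)
  let ?M = "mat_fspace \<rat> U" and ?B = "mat_fspace \<rat> Bm" and ?G = "mat_fspace \<rat> G"
  let ?T = "topspace (zariski ?E)"
  note fM = function_space_mat[of U] and fB = function_space_mat[of Bm]
  note fXY = function_space_prod[OF fs]
  note fE = function_space_prod[OF fM fXY]
  have ap: "regular_partial (?M \<otimes>\<^sub>v X) X \<alpha>" and bp: "regular_partial (?M \<otimes>\<^sub>v Y) Y \<beta>"
    and sp: "regular_partial X ?B s"
    using \<alpha> \<beta> s by (simp_all add: rational_map_iff)
  have pr: "regular_on ?E ?T fst ?M" "regular_on ?E ?T (fst \<circ> snd) X" "regular_on ?E ?T (snd \<circ> snd) Y"
    by (rule regular_on_fst[OF fM fXY],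
        rule regular_on_topspace_compose[OF regular_on_snd[OF fM fXY] regular_on_fst[OF fs]],
        rule regular_on_topspace_compose[OF regular_on_snd[OF fM fXY] regular_on_snd[OF fs]])
  define p1 where "p1 = (\<lambda>p. if p \<in> ?T then Some (fst p) else None)"
  define p2 where "p2 = (\<lambda>p. if p \<in> ?T then Some ((fst \<circ> snd) p) else None)"
  define p3 where "p3 = (\<lambda>p. if p \<in> ?T then Some ((snd \<circ> snd) p) else None)"
  have p1: "regular_partial ?E ?M p1" and p2: "regular_partial ?E X p2" and p3: "regular_partial ?E Y p3"
    unfolding p1_def p2_def p3_def by (intro regular_partial_Some fE pr)+
  define mult where "mult = (\<lambda>p. if p \<in> U \<times> Bm then Some (fst p ** snd p) else None)"
  have UG: "u ** c \<in> G" if "u \<in> U" "c \<in> Bm" for u c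
    using GL_subgroup_mult[OF G_subgroup U_subset_G[OF that(1)] Bm_subset_G[OF that(2)]] .
  have mult: "regular_partial (?M \<otimes>\<^sub>v ?B) ?G mult"
    unfolding mult_def by (rule regular_partial_Some[OF function_space_prod[OF fM fB] regular_on_matrix_mult[OF UG]])
  \<comment> \<open>\<open>fv\<close> computes \<pi>(u s(x)), the element of \<open>U\<close> that
    acts on the second factor.\<close>
  define fv where "fv = (\<lambda>p. do { g \<leftarrow> do { q \<leftarrow> do { u \<leftarrow> p1 p; b \<leftarrow> do { x \<leftarrow> p2 p; s x }; Some (u, b) }; mult q }; piU g })"
  have fv: "regular_partial ?E ?M fv"
    unfolding fv_def
    by (rule regular_partial_bind[OF fE regular_partial_bind[OF fE
          regular_partial_pair[OF fE fM fB p1 regular_partial_bind[OF fE p2 sp]] mult] piU_partial])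
  define fy where "fy = (\<lambda>p. do { q \<leftarrow> do { v \<leftarrow> fv p; y \<leftarrow> p3 p; Some (v, y) }; \<beta> q })"
  have fy: "regular_partial ?E Y fy"
    unfolding fy_def
    by (rule regular_partial_bind[OF fE regular_partial_pair[OF fE fM fs(2) fv p3] bp])
  define fx where "fx = (\<lambda>p. do { q \<leftarrow> do { u \<leftarrow> p1 p; x \<leftarrow> p2 p; Some (u, x) }; \<alpha> q })"
  have fx: "regular_partial ?E X fx"
    unfolding fx_def
    by (rule regular_partial_bind[OF fE regular_partial_pair[OF fE fM fs(1) p1 p2] ap])
  define g where "g = (\<lambda>p. do { x \<leftarrow> fx p; y \<leftarrow> fy p; Some (x, y) })"
  have "regular_partial ?E (X \<otimes>\<^sub>v Y) g"
    unfolding g_def by (rule regular_partial_pair[OF fE fs fx fy])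
  \<comment> \<open>\<open>?f\<close> carries no guards, but it is undefined off the product space
    as well: a value of \<alpha> at (u, x) and one of \<beta> at (v, y) force u, x and y into their
    spaces.\<close>
  moreover have "g = ?f"
  proof
    fix p :: "'n cmat \<times> 'x \<times> 'y"
    obtain u x y where p: "p = (u, x, y)" by (cases p)
    have top: "p \<in> ?T \<longleftrightarrow> u \<in> U \<and> x \<in> topspace (zariski X) \<and> y \<in> topspace (zariski Y)"
      by (simp add: p topspace_prod[OF fM fXY] topspace_prod[OF fs] topspace_mat)
    show "g p = ?f p"
    proof (cases "p \<in> ?T")
      case True
      then have "u \<in> U" by (simp add: top)
      show ?thesis
      proof (cases "s x")
        case None
        then show ?thesis using True by (simp add: g_def fx_def fy_def fv_def p1_def p2_def p p3_def Option.bind_eq_None_conv split: bind_splits)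
      next
        case (Some b)
        have "b \<in> Bm" using regular_partial_range_topspace[OF sp Some] by (simp add: topspace_mat)
        then have "fv p = piU (u ** b)"
          using True Some \<open>u \<in> U\<close> by (simp add: fv_def p1_def p2_def mult_def p)
        then show ?thesis
          using True Some by (simp add: g_def fx_def fy_def p1_def p2_def p3_def p)
      qed
    next
      case False
      then have "g p = None" by (simp add: g_def fx_def p1_def)
      moreover have "?f p = None"
      proof (rule ccontr)
        assume "?f p \<noteq> None"
        then obtain x' b v y' where *: "\<alpha> (u, x) = Some x'" "\<beta> (v, y) = Some y'"
          by (auto simp: p Option.bind_eq_Some_conv)
        then have "p \<in> ?T"
          using regular_partial_dom_topspace[OF ap *(1)] regular_partial_dom_topspace[OF bp *(2)]
          by (simp add: top topspace_prod[OF fM fs(1)] topspace_prod[OF fM fs(2)] topspace_mat)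
        with False show False by contradiction
      qed
      ultimately show ?thesis by (simp only:)
    qed
  qed
  ultimately show "regular_partial ?E (X \<otimes>\<^sub>v Y) ?f" by (simp only:)
next
  let ?M = "mat_fspace \<rat> U" and ?B = "mat_fspace \<rat> Bm"
  let ?L = "(?M \<otimes>\<^sub>v X) \<otimes>\<^sub>v Y"
  note fM = function_space_mat[of U]
  note fMX = function_space_prod[OF fM fs(1)] and fMY = function_space_prod[OF fM fs(2)]
  note fXY = function_space_prod[OF fs]
  note fE = function_space_prod[OF fM fXY]
  have ap: "regular_partial (?M \<otimes>\<^sub>v X) X \<alpha>" and bp: "regular_partial (?M \<otimes>\<^sub>v Y) Y \<beta>"
    and sp: "regular_partial X ?B s"
    using \<alpha> \<beta> s by (simp_all add: rational_map_iff)
  fix S assume "openin (complex_top ?E) S \<and> S \<noteq> {}"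
  then obtain u0 x0 y0 where S: "openin (complex_top ?E) S" and S0: "(u0, x0, y0) \<in> S" by auto
  have "(u0, x0, y0) \<in> topspace (zariski ?E)"
    using openin_subset[OF S] S0 by (auto simp: topspace_complex_top)
  then have top0: "u0 \<in> U" "x0 \<in> topspace (zariski X)" "y0 \<in> topspace (zariski Y)"
    by (simp_all add: topspace_prod[OF fM fXY] topspace_prod[OF fs] topspace_mat)
  \<comment> \<open>Rebracketing is needed because the pair (u, x) has to be moved with y fixed,
    whereas \<open>S\<close> lives in a product that groups x with y.\<close>
  define S' where "S' = topspace (zariski ?L) \<inter> reassoc -` S"
  have S': "openin (complex_top ?L) S'"
    unfolding S'_def
    using regular_on_complex_openin[OF fE _ S] fspace_iso_reassoc[OF fM fs] unfolding fspace_iso_def by blast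
  have S'_S: "(u, x, y) \<in> S" if "((u, x), y) \<in> S'" for u x y
    using that by (simp add: S'_def reassoc_def)
  have S'0: "((u0, x0), y0) \<in> S'"
    using S0 top0 by (simp add: S'_def reassoc_def topspace_prod[OF fMX fs(2)] topspace_prod[OF fM fs(1)] topspace_mat)
  define O1 where "O1 = {q. (q, y0) \<in> S'}"
  have O1: "openin (complex_top (?M \<otimes>\<^sub>v X)) O1"
    unfolding O1_def by (rule openin_complex_slice_right[OF fMX fs(2) S'])
  \<comment> \<open>Density of \<open>dom s\<close> is applied with \<open>u0\<close> and
    \<open>y0\<close> fixed. It makes \<open>O2\<close> nonempty, so that density of the domain of
    \<alpha> can be applied to it.\<close>
  obtain x1 b1 where x1: "x1 \<in> {x. (u0, x) \<in> O1}" "s x1 = Some b1"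
    by (rule rational_map_meets[OF s openin_complex_slice_left[OF fM fs(1) O1], of x0 u0])
      (use S'0 that in \<open>auto simp: O1_def\<close>)
  define O2 where "O2 = O1 \<inter> (topspace (zariski (?M \<otimes>\<^sub>v X)) \<inter> snd -` dom s)"
  have O2: "openin (complex_top (?M \<otimes>\<^sub>v X)) O2"
    unfolding O2_def
    by (intro openin_Int O1 openin_complex_zariski regular_on_openin[OF regular_on_snd[OF fM fs(1)]]
        regular_partial_dom[OF sp])
  have "(u0, x1) \<in> O2"
    using x1 top0(1) regular_partial_dom_topspace[OF sp x1(2)]
    by (auto simp: O2_def topspace_prod[OF fM fs(1)] topspace_mat)
  then obtain q x' where q: "q \<in> O2" "\<alpha> q = Some x'"
    by (rule rational_map_meets[OF \<alpha> O2]) (rule that)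
  obtain u x where ux: "q = (u, x)" by (cases q)
  obtain b where b: "s x = Some b" using q(1) by (auto simp: O2_def ux)
  have "b \<in> Bm" using regular_partial_range_topspace[OF sp b] by (simp add: topspace_mat)
  have uxy: "((u, x), y0) \<in> S'" using q(1) by (simp add: O2_def O1_def ux)
  \<comment> \<open>The first coordinate in \<open>O3\<close> ranges over all of \<open>U\<close>:
    it is the argument of \<beta>, and is linked to u only afterwards, through \<open>D\<close> and
    \<open>W3\<close>.\<close>
  define O3 where "O3 = topspace (zariski (?M \<otimes>\<^sub>v Y)) \<inter> snd -` {y. ((u, x), y) \<in> S'}"
  have O3: "openin (complex_top (?M \<otimes>\<^sub>v Y)) O3"
    unfolding O3_def
    by (rule regular_on_complex_openin[OF fs(2) regular_on_snd[OF fM fs(2)] openin_complex_slice_left[OF fMX fs(2) S']])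
  have "(u0, y0) \<in> O3"
    using uxy top0 by (simp add: O3_def topspace_prod[OF fM fs(2)] topspace_mat)
  then obtain r y' where r: "r \<in> O3" "\<beta> r = Some y'"
    by (rule rational_map_meets[OF \<beta> O3]) (rule that)
  obtain v y where vy: "r = (v, y)" by (cases r)
  define D where "D = {v. (v, y) \<in> dom \<beta>}"
  have D: "openin (complex_top ?M) D"
    unfolding D_def
    by (rule openin_complex_slice_right[OF fM fs(2) openin_complex_zariski[OF regular_partial_dom[OF bp]]])
  have "D \<noteq> {}" using r(2) by (auto simp: D_def vy)
  \<comment> \<open>With x and y fixed, three open conditions on u remain: staying in
    \<open>S\<close>, keeping \<alpha> defined, and sending u into \<open>D\<close>. The current
    \<open>u\<close> meets the first two, and dominance makes the third nonempty.\<close>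
  define W1 where "W1 = {u. (u, (x, y)) \<in> S}"
  define W2 where "W2 = {u. (u, x) \<in> dom \<alpha>}"
  define W3 where "W3 = {u \<in> U. \<exists>v\<in>D. piU (u ** b) = Some v}"
  have W1: "openin (complex_top ?M) W1" unfolding W1_def by (rule openin_complex_slice_right[OF fM fXY S])
  have W2: "openin (complex_top ?M) W2"
    unfolding W2_def
    by (rule openin_complex_slice_right[OF fM fs(1) openin_complex_zariski[OF regular_partial_dom[OF ap]]])
  have W3: "openin (complex_top ?M) W3" "W3 \<noteq> {}"
    unfolding W3_def using piU_translate_preimage[OF \<open>b \<in> Bm\<close> D \<open>D \<noteq> {}\<close>] by auto
  have "u \<in> W1 \<inter> W2"
    using r(1) q(2) by (auto simp: W1_def W2_def O3_def vy ux S'_S)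
  then have "(W1 \<inter> W2) \<inter> W3 \<noteq> {}"
    using unipotent_group_irreducible[OF U_subgroup U_unipotent openin_Int[OF W1 W2] _ W3] by blast
  then obtain w where w: "w \<in> W1" "w \<in> W2" "w \<in> W3" by blast
  have "(w, x, y) \<in> dom ?f"
    using w(2,3) b by (auto simp: W2_def W3_def D_def)
  moreover have "(w, x, y) \<in> S" using w(1) by (simp add: W1_def)
  ultimately show "dom ?f \<inter> S \<noteq> {}" by blast
qed

end

lemma unipotent_factorizationI:
  assumes "split_reductive G T" "opposite_borels G T B Bm" "unipotent_radical B U"
    "factorization G Bm U piBm piU"
  shows "unipotent_factorization G Bm U piBm piU"
proof (rule unipotent_factorization.intro)
  show "factorization G Bm U piBm piU" by fact
  have G: "reductive G" and T: "torus \<rat> T" using assms(1) by (simp_all add: split_reductive_def)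
  show "subgroup G GL" using G by (simp add: reductive_def connected_group_def closed_subgroup_def)
  show "subgroup Bm GL"
    using assms(2) by (simp add: opposite_borels_def borel_subgroup_def connected_solvable_def
        connected_group_def closed_subgroup_def)
  have R: "connected_normal_unipotent B U" using assms(3) by (simp add: unipotent_radical_def)
  show "subgroup U GL" using R
    by (simp add: connected_normal_unipotent_def connected_group_def closed_subgroup_def)
  show unip: "unipotent u" if "u \<in> U" for u using R that by (simp add: connected_normal_unipotent_def)
  have "subgroup U (GL\<lparr>carrier := B\<rparr>)"
    using R by (simp add: connected_normal_unipotent_def normal_imp_subgroup)
  then have "U \<subseteq> B" using subgroup.subset by fastforce
  moreover have "B \<inter> Bm = T" using assms(2) by (simp add: opposite_borels_def)
  ultimately show "Bm \<inter> U \<subseteq> {mat 1}" using torus_unipotent_trivial[OF T _ unip] by blast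
qed

theorem proposition3p4:
  fixes G T B Bm U :: "('n::finite) cmat set"
    and piBm piU :: "'n cmat \<rightharpoonup> 'n cmat"
    and X1 :: "('a, 'n) crystal" and X2 :: "('b, 'n) crystal" and X3 :: "('c, 'n) crystal"
  assumes "split_reductive G T"
    and "opposite_borels G T B Bm"
    and "unipotent_radical B U"
    and "factorization G Bm U piBm piU"
    and "unipotent_crystal G T B Bm U piBm X1"
    and "unipotent_crystal G T B Bm U piBm X2"
    and "unipotent_crystal G T B Bm U piBm X3"
  shows "let L = crystal_prod piU (crystal_prod piU X1 X2) X3;
             R = crystal_prod piU X1 (crystal_prod piU X2 X3)
         in fspace_iso (underlying L) (underlying R) reassoc \<and>
            rat_eq (mat_fspace \<rat> U \<otimes>\<^sub>v underlying R) (underlying R)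
              (\<lambda>(u, x, y, z). map_option reassoc (act L (u, (x, y), z))) (act R) \<and>
            rat_eq (underlying R) (mat_fspace \<rat> Bm)
              (\<lambda>(x, y, z). str L ((x, y), z)) (str R)"
proof -
  interpret unipotent_factorization G Bm U piBm piU
    by (rule unipotent_factorizationI[OF assms(1-4)])
  have crystal: "function_space (underlying X)"
      "rational_map (mat_fspace \<rat> U \<otimes>\<^sub>v underlying X) (underlying X) (act X)"
      "rational_map (underlying X) (mat_fspace \<rat> Bm) (str X)"
    if "unipotent_crystal G T B Bm U piBm X" for X :: "('d, 'n) crystal"
    using that unfolding unipotent_crystal_def U_variety_def irreducible_variety_def rational_action_def
    by (auto intro: function_space_variety)
  note c1 = crystal[OF assms(5)] and c2 = crystal[OF assms(6)] and c3 = crystal[OF assms(7)]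
  let ?X23 = "underlying X2 \<otimes>\<^sub>v underlying X3"
  define L where "L = crystal_prod piU (crystal_prod piU X1 X2) X3"
  define R where "R = crystal_prod piU X1 (crystal_prod piU X2 X3)"
  have X23: "function_space ?X23" by (rule function_space_prod[OF c2(1) c3(1)])
  have uL: "underlying L = (underlying X1 \<otimes>\<^sub>v underlying X2) \<otimes>\<^sub>v underlying X3"
    and uR: "underlying R = underlying X1 \<otimes>\<^sub>v ?X23"
    by (simp_all add: L_def R_def crystal_prod_def)
  \<comment> \<open>Rationality is established for the right-bracketed product; the left-bracketed
    formulas inherit it by being the same partial functions.\<close>
  have "rational_map (mat_fspace \<rat> U \<otimes>\<^sub>v ?X23) ?X23 (act (crystal_prod piU X2 X3))"
    using rational_map_act_prod[OF c2(1) c3(1) c2(2) c3(2) c2(3)] by (simp add: crystal_prod_def)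
  from rational_map_act_prod[OF c1(1) X23 c1(2) this c1(3)]
  have actR: "rational_map (mat_fspace \<rat> U \<otimes>\<^sub>v underlying R) (underlying R) (act R)"
    unfolding uR by (simp add: R_def crystal_prod_def)
  have "rational_map ?X23 (mat_fspace \<rat> Bm) (str (crystal_prod piU X2 X3))"
    using rational_map_str_prod[OF c2(1) c3(1) c2(3) c3(3)] by (simp add: crystal_prod_def)
  from rational_map_str_prod[OF c1(1) X23 c1(3) this]
  have strR: "rational_map (underlying R) (mat_fspace \<rat> Bm) (str R)"
    unfolding uR by (simp add: R_def crystal_prod_def)
  \<comment> \<open>The case distinctions follow the order of the binds. If the action or the
    structure morphism of \<open>X1\<close>, or \<open>piU\<close>, is undefined, both sides are
    \<open>None\<close>.\<close>
  have "(\<lambda>(u, x, y, z). map_option reassoc (act L (u, (x, y), z))) = act R"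
  proof (rule ext, clarify)
    fix u x y z
    show "map_option reassoc (act L (u, (x, y), z)) = act R (u, x, y, z)"
    proof (cases "act X1 (u, x)"; cases "str X1 x")
      fix x' b assume xb: "act X1 (u, x) = Some x'" "str X1 x = Some b"
      show ?thesis
      proof (cases "piU (u ** b)")
        case (Some v)
        \<comment> \<open>\<open>\<pi>(u b c) = \<pi>(\<pi>(u b) c)\<close>\<close>
        have "piU (u ** (b ** c)) = piU (v ** c)" for c
          using piU_mult_cong[OF Some] by (simp add: matrix_mul_assoc)
        then show ?thesis
          by (cases "act X2 (v, y)"; cases "str X2 y")
            (simp_all add: L_def R_def crystal_prod_def xb Some reassoc_def map_option_bind o_def)
      qed (simp add: L_def R_def crystal_prod_def xb)
    qed (simp_all add: L_def R_def crystal_prod_def)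
  qed
  moreover have "(\<lambda>(x, y, z). str L ((x, y), z)) = str R"
  proof (rule ext, clarify)
    fix x y z
    show "str L ((x, y), z) = str R (x, y, z)"
      by (cases "str X1 x"; cases "str X2 y"; cases "str X3 z")
        (simp_all add: L_def R_def crystal_prod_def matrix_mul_assoc)
  qed
  moreover have "fspace_iso (underlying L) (underlying R) reassoc"
    unfolding uL uR by (rule fspace_iso_reassoc[OF c1(1) c2(1) c3(1)])
  ultimately show ?thesis
    unfolding Let_def L_def[symmetric] R_def[symmetric]
    using rat_eq_refl[OF actR] rat_eq_refl[OF strR] by simp
qed

end
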